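(* Consider the water filling policy with arrival rate $\lambda\in[0,1)$, probe rate $\delta>0$ and a phase-type job size distribution $(\alpha,S)$ with mean $1$, and let $y=\alpha(\delta I-S)^{-1}s^*$. Let $(m,c)$, with $m=\lfloor\tilde m\rfloor$ and $c\in[0,1)$, be the parameters of the queue at the cavity, and let $\pi_q$ denote the stationary probability that its queue length equals $q$. Then $\pi_0=1-\lambda$ and $$\pi_q=(1-\lambda)\,(1/y-1)/y^{q-1},\qquad q=1,\dots,m-1 .$$ Further, $$\pi_{m+1}=1-\frac1c\left(\frac\lambda\delta-\sum_{q=0}^{m-1}(m-q)\,\pi_q\right),$$ and $$\pi_m=1-(1-\lambda)\,y^{1-m}-\pi_{m+1}.$$
   Context: Job sizes have a phase-type (PH) distribution $(\alpha,S)$: $\alpha$ is a probability row vector of length $n_s$, $S$ an invertible $n_s\times n_s$ subgenerator matrix, $s^*=-S\mathbf 1$ ($\mathbf 1$ the all-ones column), and the mean is $\alpha(-S)^{-1}\mathbf 1=1$. Let $$\tilde m=\frac{\log\left(\frac1y+\left(\frac{\lambda}{\delta(1-\lambda)}-1\right)\frac{1-y}{y}\right)}{\log(1/y)}.$$ Water filling chain: for an integer $m\ge0$ and $c\in[0,1]$, consider the continuous-time Markov chain on the states $0$ and $(q,j)$, $1\le q\le m+1$, $1\le j\le n_s$ ($q$ = queue length, $j$ = service phase), with transitions: (i) $(q,j)\to(q,j')$ at rate $S_{jj'}$, $j\ne j'$; (ii) $(q,j)\to(q-1,j')$ at rate $s_j^*\alpha_{j'}$ if $q\ge2$, and $(1,j)\to0$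 at rate $s^*_j$; (iii) from $(q,j)$ with $1\le q\le m$: to $(m+1,j)$ at rate $\delta c$, and, if $q<m$, to $(m,j)$ at rate $\delta(1-c)$; (iv) from $0$: to $(m+1,j)$ at rate $\delta c\,\alpha_j$, and, if $m\ge1$, to $(m,j)$ at rate $\delta(1-c)\alpha_j$. Let $\pi_0(m,c)$ be the stationary probability of state $0$. The queue at the cavity of the water filling policy with arrival rate $\lambda$ is the stationary version of this chain for the unique pair $(m,c)$, $m\in\{0,1,\dots\}$, $c\in[0,1)$, such that $\pi_0(m,c)=1-\lambda$. In the setting of the result, $m=\lfloor\tilde m\rfloor$ and $c\in[0,1)$ is the unique value such that $$1-\lambda=\frac{y^{m-1}/\delta}{1/\delta+\kappa(-K)^{-1}\mathbf 1},\qquad \kappa=(1-c,c)\otimes\left(y^{m-1}\alpha+(1-y^{m-1})\alpha'\right),\qquad K=\begin{pmatrix}S-\delta cI&\delta cI\\ s^*\alpha&S\end{pmatrix},$$ with $\alpha'=\alpha(\delta I-S)^{-1}/\left(\alpha(\delta I-S)^{-1}\mathbf 1\right)$.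
   Formalization: The formula for π_m is stated only for m ≥ 1, since at m = 0 it contradicts π_0 = 1−λ (it gives (1−λ)(1−y)); the formula for π_{m+1} is stated for c ≠ 0, where 1/c makes sense, and for c = 0 it is replaced by π_{m+1} = 0. *)

theory Defs
  imports "HOL-Analysis.Analysis"
begin

section \<open>Phase-type distributions\<close>

text \<open>Phases are the elements of the finite index type \<open>'n\<close>. The vector \<open>1 :: real^'n\<close> is the
  all-ones vector, \<open>mat x\<close> is \<open>x\<close> times the identity matrix, and a product (row vector)(column
  vector) is an inner product.\<close>

definition subgenerator :: "real^'n^'n \<Rightarrow> bool" where
  "subgenerator S \<longleftrightarrow> (\<forall>i j. i \<noteq> j \<longrightarrow> 0 \<le> S $ i $ j) \<and> (\<forall>i. (\<Sum>j\<in>UNIV. S $ i $ j) \<le> 0)"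

definition phase_type :: "real^'n \<Rightarrow> real^'n^'n \<Rightarrow> bool" where
  "phase_type \<alpha> S \<longleftrightarrow>
     (\<forall>i. 0 \<le> \<alpha> $ i) \<and> (\<Sum>i\<in>UNIV. \<alpha> $ i) = 1 \<and> subgenerator S \<and> invertible S"

definition exit_rates :: "real^'n^'n \<Rightarrow> real^'n" where
  "exit_rates S = - (S *v 1)"

definition ph_mean :: "real^'n \<Rightarrow> real^'n^'n \<Rightarrow> real" where
  "ph_mean \<alpha> S = \<alpha> \<bullet> (matrix_inv (- S) *v 1)"

definition ph_laplace :: "real^'n \<Rightarrow> real^'n^'n \<Rightarrow> real \<Rightarrow> real" where
  "ph_laplace \<alpha> S \<delta> = \<alpha> \<bullet> (matrix_inv (mat \<delta> - S) *v exit_rates S)"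


section \<open>Stationary distributions of finite continuous-time Markov chains\<close>

text \<open>A chain is given by a finite set \<open>X\<close> of states and the jump rates \<open>r x z\<close> from \<open>x\<close> to \<open>z\<close>;
  stationarity is expressed by the global balance equations.\<close>

definition stationary_distribution :: "'s set \<Rightarrow> ('s \<Rightarrow> 's \<Rightarrow> real) \<Rightarrow> ('s \<Rightarrow> real) \<Rightarrow> bool" where
  "stationary_distribution X r \<pi> \<longleftrightarrow>
     (\<forall>x\<in>X. 0 \<le> \<pi> x) \<and> (\<Sum>x\<in>X. \<pi> x) = 1 \<and>
     (\<forall>x\<in>X. \<pi> x * (\<Sum>z\<in>X - {x}. r x z) = (\<Sum>z\<in>X - {x}. \<pi> z * r z x))"


section \<open>The water filling chain\<close>

datatype 'n wf_state = Empty | Busy nat 'n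

fun queue_length :: "'n wf_state \<Rightarrow> nat" where
  "queue_length Empty = 0"
| "queue_length (Busy q j) = q"

definition wf_states :: "nat \<Rightarrow> 'n wf_state set" where
  "wf_states m = insert Empty {Busy q j | q j. 1 \<le> q \<and> q \<le> m + 1}"

fun wf_rate :: "real^'n \<Rightarrow> real^'n^'n \<Rightarrow> real \<Rightarrow> nat \<Rightarrow> real \<Rightarrow> 'n wf_state \<Rightarrow> 'n wf_state \<Rightarrow> real" where
  "wf_rate \<alpha> S \<delta> m c Empty Empty = 0"
| "wf_rate \<alpha> S \<delta> m c Empty (Busy q' j') =
     (if q' = m + 1 then \<delta> * c * \<alpha> $ j' else 0) +
     (if 1 \<le> m \<and> q' = m then \<delta> * (1 - c) * \<alpha> $ j' else 0)"
| "wf_rate \<alpha> S \<delta> m c (Busy q j) Empty = (if q = 1 then exit_rates S $ j else 0)"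
| "wf_rate \<alpha> S \<delta> m c (Busy q j) (Busy q' j') =
     (if q' = q \<and> j' \<noteq> j then S $ j $ j' else 0) +
     (if 2 \<le> q \<and> q' = q - 1 then exit_rates S $ j * \<alpha> $ j' else 0) +
     (if 1 \<le> q \<and> q \<le> m \<and> q' = m + 1 \<and> j' = j then \<delta> * c else 0) +
     (if 1 \<le> q \<and> q < m \<and> q' = m \<and> j' = j then \<delta> * (1 - c) else 0)"

definition wf_stationary ::
    "real^'n \<Rightarrow> real^'n^'n \<Rightarrow> real \<Rightarrow> nat \<Rightarrow> real \<Rightarrow> ('n wf_state \<Rightarrow> real) \<Rightarrow> bool" where
  "wf_stationary \<alpha> S \<delta> m c \<pi> \<longleftrightarrow> stationary_distribution (wf_states m) (wf_rate \<alpha> S \<delta> m c) \<pi>"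

definition queue_length_prob :: "nat \<Rightarrow> ('n wf_state \<Rightarrow> real) \<Rightarrow> nat \<Rightarrow> real" where
  "queue_length_prob m \<pi> q = (\<Sum>x | x \<in> wf_states m \<and> queue_length x = q. \<pi> x)"


section \<open>The queue at the cavity\<close>

definition cavity_parameters ::
    "real^'n \<Rightarrow> real^'n^'n \<Rightarrow> real \<Rightarrow> real \<Rightarrow> nat \<Rightarrow> real \<Rightarrow> bool" where
  "cavity_parameters \<alpha> S \<delta> lam m c \<longleftrightarrow>
     0 \<le> c \<and> c < 1 \<and> (\<exists>\<pi>. wf_stationary \<alpha> S \<delta> m c \<pi> \<and> queue_length_prob m \<pi> 0 = 1 - lam)"

definition m_tilde :: "real \<Rightarrow> real \<Rightarrow> real \<Rightarrow> real" where
  "m_tilde lam \<delta> y =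
     ln (1 / y + (lam / (\<delta> * (1 - lam)) - 1) * ((1 - y) / y)) / ln (1 / y)"

definition alpha' :: "real^'n \<Rightarrow> real^'n^'n \<Rightarrow> real \<Rightarrow> real^'n" where
  "alpha' \<alpha> S \<delta> =
     (1 / ((\<alpha> v* matrix_inv (mat \<delta> - S)) \<bullet> 1)) *\<^sub>R (\<alpha> v* matrix_inv (mat \<delta> - S))"

text \<open>In \<open>kappa\<close> and \<open>K_matrix\<close> the index \<open>Inl j\<close> stands for phase \<open>j\<close> in the first block (queue
  length \<open>m\<close>) and \<open>Inr j\<close> for phase \<open>j\<close> in the second block (queue length \<open>m + 1\<close>). The exponent
  \<open>m - 1\<close> is an integer, since \<open>m = 0\<close> is allowed.\<close>

definition kappa :: "real^'n \<Rightarrow> real^'n^'n \<Rightarrow> real \<Rightarrow> nat \<Rightarrow> real \<Rightarrow> real^('n + 'n)" where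
  "kappa \<alpha> S \<delta> m c =
     (let p = ph_laplace \<alpha> S \<delta> powi (int m - 1);
          \<beta> = p *\<^sub>R \<alpha> + (1 - p) *\<^sub>R alpha' \<alpha> S \<delta>
      in \<chi> a. case a of Inl j \<Rightarrow> (1 - c) * \<beta> $ j | Inr j \<Rightarrow> c * \<beta> $ j)"

definition K_matrix :: "real^'n \<Rightarrow> real^'n^'n \<Rightarrow> real \<Rightarrow> real \<Rightarrow> real^('n + 'n)^('n + 'n)" where
  "K_matrix \<alpha> S \<delta> c =
     (\<chi> a b. case a of
        Inl i \<Rightarrow> (case b of Inl j \<Rightarrow> (S - mat (\<delta> * c)) $ i $ j | Inr j \<Rightarrow> mat (\<delta> * c) $ i $ j)
      | Inr i \<Rightarrow> (case b of Inl j \<Rightarrow> exit_rates S $ i * \<alpha> $ j | Inr j \<Rightarrow> S $ i $ j))"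

end

theory Submission
  imports Defs
begin

text \<open>Write \<open>\<phi> \<theta>\<close> for the Laplace transform of the job size, so \<open>y = \<phi> \<delta>\<close>, and \<open>w q\<close> for the rate of service
  completions at queue length \<open>q\<close>. Below level \<open>m\<close> the balance equations say that the phase vector at
  level \<open>q\<close> is \<open>w (q + 1)\<close> times \<open>\<alpha> (\<delta> I - S)\<^sup>-\<^sup>1\<close>, whence \<open>w q = y w (q + 1)\<close> and the levels are
  geometric. Level \<open>m\<close> together with the conservation of work then expresses the odds of a busy server
  as \<open>\<delta> (c + (\<Sum>i<m. y\<^sup>-\<^sup>i) / \<phi> (\<delta> c))\<close>. This is continuous and increasing in the lexicographic order of
  \<open>(m, c)\<close>, which determines \<open>(m, c)\<close> from \<open>lam\<close> and gives \<open>m\<close> as a floor. The equation with \<open>kappa\<close> and \<open>K\<close>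
  reduces to the same expression because \<open>(- K)\<^sup>-\<^sup>1 1\<close> has a closed form. The formulas for levels \<open>m\<close>
  and \<open>m + 1\<close> come from equating up- and down-crossing rates of each level.\<close>

section \<open>Z-matrices and finite Markov chains\<close>

text \<open>A discrete minimum principle. With \<open>t\<close> the least ratio of \<open>x\<close>
  to \<open>h\<close>, attained at \<open>j\<close>, the vector \<open>x - t *\<^sub>R h\<close> is
  nonnegative and vanishes at \<open>j\<close>, so row \<open>j\<close> of \<open>A\<close> takes it
  to a nonpositive value. A negative \<open>t\<close> would then make \<open>(A *v x) $ j\<close>
  negative.\<close>

lemma Z_matrix_monotone:
  fixes A :: "real^'n^'n"
  assumes off: "\<And>i j. i \<noteq> j \<Longrightarrow> A $ i $ j \<le> 0"
    and h: "\<And>i. 0 < h $ i" "\<And>i. 0 < (A *v h) $ i"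
    and x: "\<And>i. 0 \<le> (A *v x) $ i"
  shows "0 \<le> x $ i"
proof (rule ccontr)
  assume neg: "\<not> 0 \<le> x $ i"
  obtain j where j: "\<And>k. x $ j / h $ j \<le> x $ k / h $ k"
    using arg_min_if_finite[of UNIV "\<lambda>k. x $ k / h $ k"]
    by (metis UNIV_I finite_class.finite_UNIV linorder_not_less empty_not_UNIV)
  define t where "t = x $ j / h $ j"
  have "t \<le> x $ i / h $ i"
    using j t_def by simp
  then have t: "t < 0"
    using neg h(1)[of i] by (smt (verit) divide_neg_pos)
  have le: "t * h $ k \<le> x $ k" for k
    using j[of k] h(1)[of k] by (simp add: t_def le_divide_eq)
  have eq: "x $ j = t * h $ j"
    using h(1)[of j] by (simp add: t_def)
  have "(A *v x) $ j = (\<Sum>k\<in>UNIV. A $ j $ k * (x $ k - t * h $ k)) + t * (A *v h) $ j"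
    by (simp add: matrix_vector_mult_def right_diff_distrib sum_subtractf sum_distrib_left algebra_simps)
  moreover have "(\<Sum>k\<in>UNIV. A $ j $ k * (x $ k - t * h $ k)) \<le> 0"
  proof (rule sum_nonpos)
    fix k
    show "A $ j $ k * (x $ k - t * h $ k) \<le> 0"
      using off[of j k] le[of k] eq by (cases "k = j") (auto intro: mult_nonpos_nonneg)
  qed
  moreover have "t * (A *v h) $ j < 0"
    using t h(2)[of j] by (rule mult_neg_pos)
  ultimately show False
    using x[of j] by linarith
qed

lemma Z_matrix_invertible:
  fixes A :: "real^'n^'n"
  assumes off: "\<And>i j. i \<noteq> j \<Longrightarrow> A $ i $ j \<le> 0"
    and h: "\<And>i. 0 < h $ i" "\<And>i. 0 < (A *v h) $ i"
  shows "invertible A"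
proof -
  have "x = 0" if x: "A *v x = 0" for x
  proof -
    have "0 \<le> x $ i" "0 \<le> (- x) $ i" for i
      using Z_matrix_monotone[OF off h, of x] Z_matrix_monotone[OF off h, of "- x"] x
      by (simp_all add: linear_neg)
    then show ?thesis
      by (auto simp: vec_eq_iff intro: antisym)
  qed
  then show ?thesis
    by (simp add: invertible_left_inverse matrix_left_invertible_ker)
qed

text \<open>Turns the evaluation of an inverse matrix into checking a candidate solution of a linear
  system.\<close>

lemma matrix_inv_mult_eq_iff:
  fixes A :: "real^'n^'n"
  assumes "invertible A"
  shows "matrix_inv A *v x = z \<longleftrightarrow> A *v z = x"
proof -
  have "A ** matrix_inv A = mat 1 \<and> matrix_inv A ** A = mat 1"
    using assms unfolding invertible_def matrix_inv_def by (rule someI_ex)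
  then show ?thesis
    by (metis matrix_vector_mul_assoc matrix_vector_mul_lid)
qed

text \<open>The state \<open>x\<close> is eliminated by passing to the chain watched off \<open>x\<close>, with rates
  \<open>r a b + r a x * r x b / e\<close>.\<close>

lemma stationary_distribution_exists:
  assumes "finite X" "X \<noteq> {}" and "\<And>x z. x \<in> X \<Longrightarrow> z \<in> X \<Longrightarrow> x \<noteq> z \<Longrightarrow> 0 \<le> r x z"
  shows "\<exists>\<pi>. stationary_distribution X r \<pi>"
  using assms
proof (induction X arbitrary: r rule: finite_ne_induct)
  case (singleton x)
  then show ?case
    by (intro exI[of _ "\<lambda>_. 1"]) (simp add: stationary_distribution_def)
next
  case (insert x F)
  define e where "e = (\<Sum>z\<in>F. r x z)"
  have rx: "0 \<le> r x z" "0 \<le> r z x" if "z \<in> F" for z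
    using insert that by auto
  have [simp]: "insert x F - {x} = F" 
    using insert by auto
  have ins: "insert x F - {a} = insert x (F - {a})" if "a \<in> F" for a
    using insert that by auto
  show ?case
  proof (cases "e = 0")
    case True
    \<comment> \<open>Here \<open>x\<close> is absorbing, so the point mass at \<open>x\<close> is
      stationary.\<close>
    then have "r x z = 0" if "z \<in> F" for z
      using that rx insert(1) sum_nonneg_eq_0_iff[of F "r x"] by (simp add: e_def)
    then show ?thesis
      using insert(1,3) by (intro exI[of _ "\<lambda>z. if z = x then 1 else 0"])
        (auto simp: stationary_distribution_def ins if_distrib[of "\<lambda>t. t * _"] sum.If_cases cong: if_cong)
  next
    case False
    then have e: "0 < e"
      using rx by (simp add: e_def sum_nonneg less_le)
    define r' where "r' a b = r a b + r a x * r x b / e" for a b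
    obtain p where p: "stationary_distribution F r' p"
    proof -
      have "0 \<le> r' a b" if "a \<in> F" "b \<in> F" "a \<noteq> b" for a b
        using that rx insert.prems e by (simp add: r'_def)
      then show ?thesis
        using insert.IH that by blast
    qed
    \<comment> \<open>The mass of \<open>x\<close> forced by its own balance equation. As
      \<open>p\<close> has mass 1 on \<open>F\<close>, the total is \<open>1 + w\<close>.\<close>
    define w where "w = (\<Sum>a\<in>F. p a * r a x) / e"
    have w: "0 \<le> w"
      using p rx e by (auto simp: w_def stationary_distribution_def intro!: divide_nonneg_pos sum_nonneg)
    have bal: "p a * (r a x + (\<Sum>z\<in>F - {a}. r a z)) = w * r x a + (\<Sum>z\<in>F - {a}. p z * r z a)"
      if a: "a \<in> F" for a
    proof -
      \<comment> \<open>The rate of returning from \<open>a\<close> to \<open>a\<close> by way of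
        \<open>x\<close>; it enters inflow and outflow alike and cancels.\<close>
      define k where "k = r a x * r x a / e"
      have "p a * (\<Sum>z\<in>F - {a}. r' a z) = (\<Sum>z\<in>F - {a}. p z * r' z a)"
        using p a by (simp add: stationary_distribution_def)
      moreover have "(\<Sum>z\<in>F - {a}. r' a z) = (\<Sum>z\<in>F - {a}. r a z) + r a x - k"
      proof -
        have "(\<Sum>z\<in>F - {a}. r' a z) = (\<Sum>z\<in>F - {a}. r a z) + r a x * (e - r x a) / e"
          using a insert(1)
          by (simp add: r'_def sum.distrib e_def sum.remove[of F a] sum_distrib_left sum_divide_distrib)
        then show ?thesis
          using e by (simp add: k_def right_diff_distrib diff_divide_distrib)
      qed
      moreover have "(\<Sum>z\<in>F - {a}. p z * r' z a) = (\<Sum>z\<in>F - {a}. p z * r z a) + w * r x a - p a * k"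
        using a insert(1) e
        by (simp add: r'_def sum.distrib w_def sum.remove[of F a] sum_distrib_left sum_distrib_right
            sum_divide_distrib algebra_simps add_divide_distrib k_def)
      ultimately show ?thesis
        by (simp add: algebra_simps)
    qed
    define T where "T = 1 + w"
    have T: "0 < T" using w by (simp add: T_def)
    define \<pi> where "\<pi> z = (if z = x then w else p z) / T" for z
    have F: "z \<noteq> x" if "z \<in> F" for z
      using that insert by auto
    have "stationary_distribution (insert x F) r \<pi>"
      unfolding stationary_distribution_def
    proof (intro conjI ballI)
      fix a assume a: "a \<in> insert x F"
      show "0 \<le> \<pi> a"
        using a T w p by (auto simp: \<pi>_def stationary_distribution_def)
      show "\<pi> a * (\<Sum>z\<in>insert x F - {a}. r a z) = (\<Sum>z\<in>insert x F - {a}. \<pi> z * r z a)"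
      proof (cases "a = x")
        case True
        then show ?thesis
          using e T F by (simp add: \<pi>_def w_def e_def[symmetric] cong: sum.cong flip: sum_divide_distrib)
      next
        case False
        then have aF: "a \<in> F" using a by auto
        have "(\<Sum>z\<in>F - {a}. \<pi> z * r z a) = (\<Sum>z\<in>F - {a}. p z * r z a) / T"
          unfolding sum_divide_distrib using F by (intro sum.cong) (auto simp: \<pi>_def)
        then show ?thesis
          using bal[OF aF] insert(1,3) F[OF aF] T by (simp add: ins[OF aF] \<pi>_def field_simps)
      qed
    next
      have "(\<Sum>z\<in>F. \<pi> z) = 1 / T"
        using F p by (simp add: \<pi>_def sum_divide_distrib[symmetric] stationary_distribution_def cong: sum.cong)
      then show "(\<Sum>z\<in>insert x F. \<pi> z) = 1"
        using insert(1,3) T by (simp add: \<pi>_def T_def field_simps)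
    qed
    then show ?thesis by blast
  qed
qed

text \<open>The source of the scalar identities below: a balance equation for a row vector is paired
  with a solved column system, where \<open>z\<close> is a value or difference of \<open>u\<close>,
  the all-ones vector or \<open>h\<close>.\<close>

lemma row_times_matrix_inner:
  fixes v :: "real^'n"
  assumes "v v* A = w" "A *v z = x"
  shows "v \<bullet> x = w \<bullet> z"
  using assms dot_lmul_matrix by metis

lemma inner_one_eq_sum: "v \<bullet> (1 :: real^'n) = (\<Sum>i\<in>UNIV. v $ i)"
  by (simp add: inner_vec_def)

lemma mat_mult_vec: "mat t *v x = t *\<^sub>R (x :: real^'n)"
  by (simp add: vec_eq_iff matrix_vector_mult_def mat_def if_distrib[of "\<lambda>a. a * _"] cong: if_cong)

section \<open>The Laplace transform of a phase-type distribution\<close>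

locale phase_type_job =
  fixes \<alpha> :: "real^'n" and S :: "real^'n^'n"
  assumes phase_type: "phase_type \<alpha> S" and mean: "ph_mean \<alpha> S = 1"
begin

abbreviation s :: "real^'n" where "s \<equiv> exit_rates S"

abbreviation \<phi> :: "real \<Rightarrow> real" where "\<phi> \<equiv> ph_laplace \<alpha> S"

definition h :: "real^'n" where "h = matrix_inv (- S) *v 1"

definition u :: "real \<Rightarrow> real^'n" where "u \<theta> = matrix_inv (mat \<theta> - S) *v s"

lemma \<alpha>_nonneg: "0 \<le> \<alpha> $ i" and \<alpha>_sum: "(\<Sum>i\<in>UNIV. \<alpha> $ i) = 1"
  and S_offdiag: "i \<noteq> j \<Longrightarrow> 0 \<le> S $ i $ j" and S_row_sum: "(\<Sum>j\<in>UNIV. S $ i $ j) \<le> 0"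
  and S_invertible: "invertible S"
  using phase_type by (auto simp: phase_type_def subgenerator_def)

lemma s_eq: "s $ i = - (\<Sum>j\<in>UNIV. S $ i $ j)"
  by (simp add: exit_rates_def matrix_vector_mult_def)

lemma s_nonneg: "0 \<le> s $ i"
  using S_row_sum[of i] by (simp add: s_eq)

lemma S_mult_one: "S *v 1 = - s"
  by (simp add: exit_rates_def)

lemma S_mult_h: "S *v h = - 1"
proof -
  have "- S *v h = 1"
    using matrix_inv_mult_eq_iff[of "- S" 1 h] scalar_invertible[of "-1" S] S_invertible
    by (simp add: h_def)
  then show ?thesis
    by (metis add.inverse_inverse diff_0 matrix_vector_mult_0 matrix_vector_mult_diff_rdistrib)
qed

text \<open>\<open>h\<close> is to be the comparison vector in \<open>Z_matrix_monotone\<close>, so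
  its positivity needs a direct argument: at a phase where \<open>h\<close> is least,
  \<open>S *v h = - 1\<close> forces \<open>h\<close> times the exit rate to be positive.\<close>

lemma h_pos: "0 < h $ i"
proof -
  obtain j where j: "\<And>k. h $ j \<le> h $ k"
    using arg_min_if_finite[of UNIV "\<lambda>k. h $ k"]
    by (metis UNIV_I finite_class.finite_UNIV linorder_not_less empty_not_UNIV)
  have "(S *v h) $ j = (\<Sum>k\<in>UNIV. S $ j $ k * (h $ k - h $ j)) - h $ j * s $ j"
    by (simp add: matrix_vector_mult_def s_eq right_diff_distrib sum_subtractf sum_distrib_left mult.commute)
  moreover have "0 \<le> (\<Sum>k\<in>UNIV. S $ j $ k * (h $ k - h $ j))"
  proof (rule sum_nonneg)
    fix k
    show "0 \<le> S $ j $ k * (h $ k - h $ j)"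
      using j[of k] S_offdiag[of j k] by (cases "k = j") auto
  qed
  ultimately have "0 < h $ j * s $ j"
    using S_mult_h by simp
  then have "0 < h $ j"
    using s_nonneg[of j] by (simp add: zero_less_mult_iff)
  then show ?thesis
    using j[of i] by simp
qed

lemma shifted_mult: "(mat \<theta> - S) *v x = \<theta> *\<^sub>R x - S *v x"
  by (simp add: matrix_vector_mult_diff_rdistrib mat_mult_vec)

lemma shifted_offdiag: "i \<noteq> j \<Longrightarrow> (mat \<theta> - S) $ i $ j \<le> 0"
  using S_offdiag[of i j] by (simp add: mat_def)

lemma shifted_mult_h_pos: "0 \<le> \<theta> \<Longrightarrow> 0 < ((mat \<theta> - S) *v h) $ i"
  using h_pos[of i] by (simp add: shifted_mult S_mult_h add_nonneg_pos)

lemma shifted_monotone: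
  assumes "0 \<le> \<theta>" and "\<And>i. 0 \<le> ((mat \<theta> - S) *v x) $ i"
  shows "0 \<le> x $ i"
  by (rule Z_matrix_monotone[OF shifted_offdiag h_pos shifted_mult_h_pos]) (use assms in auto)

lemma shifted_invertible: "0 \<le> \<theta> \<Longrightarrow> invertible (mat \<theta> - S)"
  by (rule Z_matrix_invertible[OF shifted_offdiag h_pos shifted_mult_h_pos])

lemma shifted_mult_u: "0 \<le> \<theta> \<Longrightarrow> (mat \<theta> - S) *v u \<theta> = s"
  using matrix_inv_mult_eq_iff[OF shifted_invertible] u_def by metis

lemma \<phi>_eq: "\<phi> \<theta> = \<alpha> \<bullet> u \<theta>"
  by (simp add: ph_laplace_def u_def)

lemma \<alpha>_inner_h: "\<alpha> \<bullet> h = 1"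
  using mean by (simp add: ph_mean_def h_def)

lemma \<alpha>_inner_one: "\<alpha> \<bullet> 1 = 1"
  by (simp add: inner_one_eq_sum \<alpha>_sum)

lemma \<alpha>_inner_mono: "(\<And>i. x $ i \<le> z $ i) \<Longrightarrow> \<alpha> \<bullet> x \<le> \<alpha> \<bullet> z"
  by (auto simp: inner_vec_def intro!: sum_mono mult_left_mono \<alpha>_nonneg)

text \<open>Jensen's inequality for the service time \<open>T\<close> started in phase \<open>i\<close>: \<open>u \<theta> $ i\<close> is the expectation
  of \<open>exp (- \<theta> T)\<close> and \<open>h $ i\<close> that of \<open>T\<close>.\<close>

lemma exp_le_u:
  assumes \<theta>: "0 \<le> \<theta>"
  shows "exp (- \<theta> * h $ i) \<le> u \<theta> $ i"
proof -
  define w :: "real^'n" where "w = (\<chi> k. exp (- \<theta> * h $ k))"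
  \<comment> \<open>\<open>w\<close> is a subsolution of the system solved by
    \<open>u \<theta>\<close>; monotonicity then compares the two.\<close>
  have w: "((mat \<theta> - S) *v w) $ j \<le> s $ j" for j
  proof -
    \<comment> \<open>The tangent bound on the exponential, weighted by the nonnegative off-diagonal
      rates; the diagonal term vanishes on both sides.\<close>
    have "S $ j $ k * (w $ k - w $ j) \<ge> S $ j $ k * (- \<theta> * (h $ k - h $ j) * w $ j)" for k
    proof (cases "k = j")
      case False
      have "w $ k = exp (- \<theta> * (h $ k - h $ j)) * w $ j"
        by (simp add: w_def algebra_simps flip: exp_add)
      moreover have "1 - \<theta> * (h $ k - h $ j) \<le> exp (- \<theta> * (h $ k - h $ j))"
        using exp_ge_add_one_self[of "- \<theta> * (h $ k - h $ j)"] by simp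
      ultimately have "(1 - \<theta> * (h $ k - h $ j)) * w $ j \<le> w $ k"
        by (simp add: w_def)
      then have "- \<theta> * (h $ k - h $ j) * w $ j \<le> w $ k - w $ j"
        by (simp add: algebra_simps)
      then show ?thesis
        using False S_offdiag by (intro mult_left_mono) auto
    qed simp
    then have "(\<Sum>k\<in>UNIV. S $ j $ k * (- \<theta> * (h $ k - h $ j) * w $ j)) \<le>
        (\<Sum>k\<in>UNIV. S $ j $ k * (w $ k - w $ j))"
      by (intro sum_mono)
    also have "\<dots> = (S *v w) $ j + s $ j * w $ j"
      by (simp add: matrix_vector_mult_def s_eq right_diff_distrib sum_subtractf sum_distrib_right)
    also have "(\<Sum>k\<in>UNIV. S $ j $ k * (- \<theta> * (h $ k - h $ j) * w $ j)) =
        - \<theta> * w $ j * (\<Sum>k\<in>UNIV. S $ j $ k * (h $ k - h $ j))"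
      by (simp add: sum_distrib_left algebra_simps)
    also have "(\<Sum>k\<in>UNIV. S $ j $ k * (h $ k - h $ j)) = (S *v h) $ j + s $ j * h $ j"
      by (simp add: matrix_vector_mult_def s_eq right_diff_distrib sum_subtractf sum_distrib_right)
    finally have "\<theta> * w $ j - (S *v w) $ j \<le> s $ j * ((1 + \<theta> * h $ j) * w $ j)"
      by (simp add: S_mult_h algebra_simps)
    also have "(1 + \<theta> * h $ j) * w $ j \<le> exp (\<theta> * h $ j) * w $ j"
      by (intro mult_right_mono exp_ge_add_one_self) (simp add: w_def)
    then have "s $ j * ((1 + \<theta> * h $ j) * w $ j) \<le> s $ j"
      using s_nonneg[of j] by (simp add: w_def mult_left_le flip: exp_add)
    finally show ?thesis
      by (simp add: shifted_mult)
  qed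
  have "0 \<le> (u \<theta> - w) $ i"
    by (rule shifted_monotone[OF \<theta>])
      (simp add: w matrix_vector_mult_diff_distrib shifted_mult_u[OF \<theta>])
  then show ?thesis
    by (simp add: w_def)
qed

section \<open>Bounds, monotonicity and continuity of the Laplace transform\<close>

lemma u_pos: "0 \<le> \<theta> \<Longrightarrow> 0 < u \<theta> $ i"
  using exp_le_u[of \<theta> i] by (smt (verit) exp_gt_zero)

lemma u_le_one: "0 \<le> \<theta> \<Longrightarrow> u \<theta> $ i \<le> 1"
proof -
  assume \<theta>: "0 \<le> \<theta>"
  have "0 \<le> (1 - u \<theta>) $ i"
  proof (rule shifted_monotone[OF \<theta>])
    fix j
    show "0 \<le> ((mat \<theta> - S) *v (1 - u \<theta>)) $ j"
      unfolding matrix_vector_mult_diff_distrib shifted_mult_u[OF \<theta>]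
      using \<theta> by (simp add: shifted_mult S_mult_one)
  qed
  then show ?thesis by simp
qed

lemma u_0: "u 0 = 1"
  unfolding u_def
  by (subst matrix_inv_mult_eq_iff[OF shifted_invertible]) (simp_all only: shifted_mult S_mult_one, simp_all)

lemma \<phi>_0: "\<phi> 0 = 1"
  by (simp add: \<phi>_eq u_0 \<alpha>_inner_one)

lemma \<phi>_pos:
  assumes "0 \<le> \<theta>"
  shows "0 < \<phi> \<theta>"
proof -
  obtain i where "\<alpha> $ i \<noteq> 0"
    using \<alpha>_sum by (metis sum.neutral zero_neq_one)
  then have "0 < \<alpha> $ i * u \<theta> $ i"
    using \<alpha>_nonneg[of i] u_pos[OF assms, of i] by simp
  also have "\<dots> \<le> \<phi> \<theta>"
    unfolding \<phi>_eq inner_vec_def inner_real_def using \<alpha>_nonneg u_pos[OF assms]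
    by (intro member_le_sum) (auto simp: less_imp_le)
  finally show ?thesis .
qed

text \<open>The gap is quantitative: \<open>1 - u \<theta>\<close> dominates
  \<open>(\<theta> / H) *\<^sub>R h\<close>, and averaging against \<alpha> gives
  \<open>1 - \<phi> \<theta> \<ge> \<theta> / H\<close> because the mean is 1.\<close>

lemma \<phi>_less_one:
  assumes \<theta>: "0 < \<theta>"
  shows "\<phi> \<theta> < 1"
proof -
  \<comment> \<open>A bound for \<open>1 + \<theta> * h $ k\<close> in all phases, so that
    \<open>mat \<theta> - S\<close> takes \<open>(\<theta> / H) *\<^sub>R h\<close> to a vector
    below \<theta>.\<close>
  define H where "H = 1 + \<theta> * (\<Sum>k\<in>UNIV. h $ k)"
  have hH: "1 + \<theta> * h $ k \<le> H" for k
    using \<theta> member_le_sum[of k UNIV "\<lambda>k. h $ k"] h_pos by (simp add: H_def less_imp_le)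
  have H: "0 < H"
    using hH[of undefined] \<theta> h_pos[of undefined] by (smt (verit) mult_pos_pos)
  have "0 \<le> (1 - u \<theta> - (\<theta> / H) *\<^sub>R h) $ k" for k
  proof (rule shifted_monotone[OF less_imp_le[OF \<theta>]])
    fix j
    have "(1 + \<theta> * h $ j) * (\<theta> / H) \<le> H * (\<theta> / H)"
      using hH[of j] \<theta> H by (intro mult_right_mono) auto
    then have "(\<theta> / H) * (\<theta> * h $ j + 1) \<le> \<theta>"
      using H by (simp add: algebra_simps)
    moreover have "(mat \<theta> - S) *v (1 - u \<theta> - (\<theta> / H) *\<^sub>R h) = \<theta> *\<^sub>R 1 - (\<theta> / H) *\<^sub>R (\<theta> *\<^sub>R h + 1)"
      using \<theta> by (simp only: matrix_vector_mult_diff_distrib matrix_vector_mult_scaleR shifted_mult_u less_imp_le)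
        (simp add: shifted_mult S_mult_one S_mult_h)
    ultimately show "0 \<le> ((mat \<theta> - S) *v (1 - u \<theta> - (\<theta> / H) *\<^sub>R h)) $ j"
      by simp
  qed
  then have "\<alpha> \<bullet> ((\<theta> / H) *\<^sub>R h) \<le> \<alpha> \<bullet> (1 - u \<theta>)"
    by (intro \<alpha>_inner_mono) (simp add: algebra_simps)
  then have "\<theta> / H \<le> 1 - \<phi> \<theta>"
    by (simp add: \<alpha>_inner_h \<alpha>_inner_one \<phi>_eq inner_diff_right)
  moreover have "0 < \<theta> / H"
    using \<theta> H by simp
  ultimately show ?thesis by linarith
qed

text \<open>The resolvent identity. Besides continuity of \<open>\<phi>\<close>, it later evaluates
  inner products with \<open>u (\<delta> * c)\<close> of vectors governed by the shift
  \<delta>.\<close>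

lemma shifted_mult_u_diff:
  assumes "0 \<le> a" "0 \<le> b"
  shows "(mat b - S) *v (u a - u b) = (b - a) *\<^sub>R u a"
proof -
  have "(mat b - S) *v u a = (mat a - S) *v u a + (b - a) *\<^sub>R u a"
    by (simp add: shifted_mult scaleR_left_diff_distrib)
  then show ?thesis
    using shifted_mult_u[OF assms(1)] shifted_mult_u[OF assms(2)] by (simp add: matrix_vector_mult_diff_distrib)
qed

text \<open>The Lipschitz constant is the mean job size: \<open>u a - u b\<close> lies between 0 and
  \<open>(b - a) *\<^sub>R h\<close>, and \<alpha> averages \<open>h\<close> to 1.\<close>

lemma \<phi>_lipschitz:
  assumes "0 \<le> a" "a \<le> b"
  shows "\<phi> b \<le> \<phi> a" "\<phi> a - \<phi> b \<le> b - a"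
proof -
  have b: "0 \<le> b" using assms by simp
  note eq = shifted_mult_u_diff[OF assms(1) b]
  have "0 \<le> (u a - u b) $ i" for i
    by (rule shifted_monotone[OF b]) (use assms u_pos[OF assms(1)] in \<open>simp add: eq less_imp_le\<close>)
  then have "\<alpha> \<bullet> u b \<le> \<alpha> \<bullet> u a"
    by (intro \<alpha>_inner_mono) simp
  then show "\<phi> b \<le> \<phi> a"
    by (simp add: \<phi>_eq)
  have "0 \<le> ((b - a) *\<^sub>R h - (u a - u b)) $ i" for i
  proof (rule shifted_monotone[OF b])
    fix j
    have "(b - a) * u a $ j \<le> (b - a) * 1"
      using assms u_le_one[of a j] by (intro mult_left_mono) auto
    moreover have "0 \<le> (b - a) * (b * h $ j)"
      using assms h_pos[of j] by simp
    ultimately have "(b - a) * u a $ j \<le> (b - a) * (b * h $ j + 1)"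
      by (simp only: distrib_left)
    then show "0 \<le> ((mat b - S) *v ((b - a) *\<^sub>R h - (u a - u b))) $ j"
      unfolding matrix_vector_mult_diff_distrib[of _ _ "u a - u b"] eq matrix_vector_mult_scaleR
      by (simp add: shifted_mult S_mult_h)
  qed
  then have "\<alpha> \<bullet> (u a - u b) \<le> \<alpha> \<bullet> ((b - a) *\<^sub>R h)"
    by (intro \<alpha>_inner_mono) simp
  then show "\<phi> a - \<phi> b \<le> b - a"
    by (simp add: \<phi>_eq \<alpha>_inner_h inner_diff_right)
qed

lemma \<phi>_continuous: "continuous_on {0..} \<phi>"
proof (rule continuous_onI)
  fix a e :: real
  assume "a \<in> {0..}" "0 < e"
  moreover have "\<bar>\<phi> b - \<phi> a\<bar> \<le> \<bar>b - a\<bar>" if "0 \<le> b" for b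
    using \<phi>_lipschitz[of a b] \<phi>_lipschitz[of b a] that \<open>a \<in> {0..}\<close> by (cases "a \<le> b") auto
  ultimately show "\<exists>d>0. \<forall>b\<in>{0..}. dist b a < d \<longrightarrow> dist (\<phi> b) (\<phi> a) \<le> e"
    by (intro exI[of _ e]) (force simp: dist_real_def)
qed

end

section \<open>Balance equations of the water filling chain\<close>

lemma wf_states_eq:
  "wf_states m = insert Empty ((\<lambda>(q, j). Busy q j) ` ({1..m + 1} \<times> (UNIV :: 'n set)))"
  by (auto simp: wf_states_def)

lemma sum_wf_states:
  fixes f :: "'n::finite wf_state \<Rightarrow> real"
  shows "(\<Sum>x\<in>wf_states m. f x) = f Empty + (\<Sum>q=1..m + 1. \<Sum>j\<in>UNIV. f (Busy q j))"
proof -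
  have "inj_on (\<lambda>(q, j). Busy q j) ({1..m + 1} \<times> (UNIV :: 'n set))"
    by (auto simp: inj_on_def)
  then have "(\<Sum>x\<in>(\<lambda>(q, j). Busy q j) ` ({1..m + 1} \<times> (UNIV :: 'n set)). f x) =
      (\<Sum>q=1..m + 1. \<Sum>j\<in>UNIV. f (Busy q j))"
    by (simp add: sum.reindex case_prod_unfold sum.cartesian_product)
  then show ?thesis
    unfolding wf_states_eq by (subst sum.insert) auto
qed

lemma finite_wf_states: "finite (wf_states m :: 'n::finite wf_state set)"
  by (simp add: wf_states_eq)

lemma sum_single_level:
  assumes "finite A" and "\<And>q j. q \<in> A \<Longrightarrow> q \<noteq> a \<Longrightarrow> f q j = 0"
  shows "(\<Sum>q\<in>A. \<Sum>j\<in>B. f q j) = (if a \<in> A then \<Sum>j\<in>B. f a j else 0)"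
proof -
  have "(\<Sum>q\<in>A. \<Sum>j\<in>B. f q j) = (\<Sum>q\<in>A. if q = a then \<Sum>j\<in>B. f a j else 0)"
    using assms by (intro sum.cong refl) auto
  then show ?thesis
    using assms(1) by simp
qed

lemma sum_restrict_level:
  assumes "finite A" and "\<And>q. q \<in> A \<Longrightarrow> P q \<longleftrightarrow> q \<in> B" and "B \<subseteq> A"
  shows "(\<Sum>q\<in>A. if P q then f q else 0) = (\<Sum>q\<in>B. f q)"
  using assms by (subst sum.inter_filter[symmetric]) (auto intro!: sum.cong)

text \<open>Allows the balance equations to be summed over all states, without excluding the state
  itself.\<close>

lemma wf_rate_refl: "wf_rate \<alpha> S \<delta> m c x x = 0"
  by (cases x) auto

lemma wf_stationary_balance:
  assumes "wf_stationary \<alpha> S \<delta> m c \<pi>" and "x \<in> wf_states m"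
  shows "\<pi> x * (\<Sum>z\<in>wf_states m. wf_rate \<alpha> S \<delta> m c x z) =
    (\<Sum>z\<in>wf_states m. \<pi> z * wf_rate \<alpha> S \<delta> m c z x)"
  using assms by (simp add: wf_stationary_def stationary_distribution_def finite_wf_states
      wf_rate_refl sum.remove[of "wf_states m" x])

locale water_filling = phase_type_job +
  fixes \<delta> :: real and m :: nat and c :: real and \<pi> :: "'a wf_state \<Rightarrow> real"
  assumes \<delta>_pos: "0 < \<delta>" and c: "0 \<le> c" "c < 1" and stationary: "wf_stationary \<alpha> S \<delta> m c \<pi>"
begin

section \<open>Total rates out of and into each state\<close>

definition v :: "nat \<Rightarrow> real^'a" where "v q = (\<chi> j. \<pi> (Busy q j))"

definition w :: "nat \<Rightarrow> real" where "w q = v q \<bullet> s"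

abbreviation p0 :: real where "p0 \<equiv> \<pi> Empty"

abbreviation rate :: "'a wf_state \<Rightarrow> 'a wf_state \<Rightarrow> real" where "rate \<equiv> wf_rate \<alpha> S \<delta> m c"

lemma normalization: "p0 + (\<Sum>q=1..m + 1. v q \<bullet> 1) = 1"
  using stationary
  by (simp add: wf_stationary_def stationary_distribution_def sum_wf_states inner_one_eq_sum v_def)

text \<open>Phase changes and the completion together leave phase \<open>j\<close> at rate
  \<open>- S $ j $ j\<close> on every level; only the arrival terms depend on
  \<open>q\<close>.\<close>

lemma rate_out:
  assumes q: "1 \<le> q" "q \<le> m + 1"
  shows "(\<Sum>z\<in>wf_states m. rate (Busy q j) z) =
    (if q \<le> m then \<delta> * c else 0) + (if q < m then \<delta> * (1 - c) else 0) - S $ j $ j"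
proof -
  let ?A = "{1..m + 1}"
  have "(\<Sum>q'\<in>?A. \<Sum>j'\<in>UNIV. if q' = q \<and> j' \<noteq> j then S $ j $ j' else 0) = - s $ j - S $ j $ j"
  proof -
    have "(\<Sum>q'\<in>?A. \<Sum>j'\<in>UNIV. if q' = q \<and> j' \<noteq> j then S $ j $ j' else 0) =
        (\<Sum>j'\<in>UNIV. if j' \<noteq> j then S $ j $ j' else 0)"
      using q by (subst sum_single_level[where a = q]) auto
    also have "\<dots> = (\<Sum>j'\<in>UNIV. S $ j $ j') - S $ j $ j"
      by (simp add: sum.remove[of UNIV j])
    finally show ?thesis
      by (simp add: s_eq)
  qed
  \<comment> \<open>A completion at level 1 leads to \<open>Empty\<close>, whose term
    \<open>sum_wf_states\<close> splits off.\<close>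
  moreover have "(\<Sum>q'\<in>?A. \<Sum>j'\<in>UNIV. if 2 \<le> q \<and> q' = q - 1 then s $ j * \<alpha> $ j' else 0) =
      (if q = 1 then 0 else s $ j)"
    using q by (subst sum_single_level[where a = "q - 1"]) (auto simp: \<alpha>_sum simp flip: sum_distrib_left)
  moreover have "(\<Sum>q'\<in>?A. \<Sum>j'\<in>UNIV. if 1 \<le> q \<and> q \<le> m \<and> q' = m + 1 \<and> j' = j then \<delta> * c else 0) =
      (if q \<le> m then \<delta> * c else 0)"
    using q by (subst sum_single_level[where a = "m + 1"]) auto
  moreover have "(\<Sum>q'\<in>?A. \<Sum>j'\<in>UNIV. if 1 \<le> q \<and> q < m \<and> q' = m \<and> j' = j then \<delta> * (1 - c) else 0) =
      (if q < m then \<delta> * (1 - c) else 0)"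
    using q by (subst sum_single_level[where a = m]) auto
  ultimately show ?thesis
    by (simp add: sum_wf_states sum.distrib del: sum.delta)
qed

lemma rate_in:
  assumes q: "1 \<le> q" "q \<le> m + 1"
  shows "(\<Sum>z\<in>wf_states m. \<pi> z * rate z (Busy q j)) =
    p0 * rate Empty (Busy q j) + ((v q v* S) $ j - v q $ j * S $ j $ j) +
    (if q \<le> m then w (q + 1) * \<alpha> $ j else 0) +
    (if q = m + 1 then \<delta> * c * (\<Sum>k=1..m. v k $ j) else 0) +
    (if q = m then \<delta> * (1 - c) * (\<Sum>k=1..<m. v k $ j) else 0)"
proof -
  let ?A = "{1..m + 1}"
  have "(\<Sum>k\<in>?A. \<Sum>i\<in>UNIV. v k $ i * (if q = k \<and> j \<noteq> i then S $ i $ j else 0)) =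
      (v q v* S) $ j - v q $ j * S $ j $ j"
  proof -
    have "(\<Sum>k\<in>?A. \<Sum>i\<in>UNIV. v k $ i * (if q = k \<and> j \<noteq> i then S $ i $ j else 0)) =
        (\<Sum>i\<in>UNIV. v q $ i * (if j \<noteq> i then S $ i $ j else 0))"
      using q by (subst sum_single_level[where a = q]) auto
    also have "\<dots> = (\<Sum>i\<in>UNIV. v q $ i * S $ i $ j) - v q $ j * S $ j $ j"
      by (simp add: sum.remove[of UNIV j] cong: if_cong)
    finally show ?thesis
      by (simp add: vector_matrix_mult_def mult.commute)
  qed
  moreover have "(\<Sum>k\<in>?A. \<Sum>i\<in>UNIV. v k $ i * (if 2 \<le> k \<and> q = k - 1 then s $ i * \<alpha> $ j else 0)) =
      (if q \<le> m then w (q + 1) * \<alpha> $ j else 0)"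
    using q by (subst sum_single_level[where a = "q + 1"])
      (auto simp: w_def inner_vec_def sum_distrib_right mult.assoc)
  moreover have "(\<Sum>k\<in>?A. \<Sum>i\<in>UNIV. v k $ i *
        (if 1 \<le> k \<and> k \<le> m \<and> q = m + 1 \<and> j = i then \<delta> * c else 0)) =
      (if q = m + 1 then \<delta> * c * (\<Sum>k=1..m. v k $ j) else 0)"
  proof -
    have "(\<Sum>i\<in>UNIV. v k $ i * (if 1 \<le> k \<and> k \<le> m \<and> q = m + 1 \<and> j = i then \<delta> * c else 0)) =
        (if k \<le> m \<and> q = m + 1 then \<delta> * c * v k $ j else 0)" if "k \<in> ?A" for k
      using that by (auto simp: if_distrib[of "(*) _"] cong: if_cong)
    then have "(\<Sum>k\<in>?A. \<Sum>i\<in>UNIV. v k $ i *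
          (if 1 \<le> k \<and> k \<le> m \<and> q = m + 1 \<and> j = i then \<delta> * c else 0)) =
        (\<Sum>k\<in>?A. if k \<le> m \<and> q = m + 1 then \<delta> * c * v k $ j else 0)"
      by (rule sum.cong[OF refl])
    also have "\<dots> = (if q = m + 1 then \<Sum>k=1..m. \<delta> * c * v k $ j else 0)"
    proof -
      have "(\<Sum>k\<in>?A. if k \<le> m then \<delta> * c * v k $ j else 0) = (\<Sum>k=1..m. \<delta> * c * v k $ j)"
        by (rule sum_restrict_level) auto
      then show ?thesis
        by (cases "q = m + 1") (simp_all del: sum.cl_ivl_Suc)
    qed
    finally show ?thesis
      by (simp add: sum_distrib_left)
  qed
  moreover have "(\<Sum>k\<in>?A. \<Sum>i\<in>UNIV. v k $ i *
        (if 1 \<le> k \<and> k < m \<and> q = m \<and> j = i then \<delta> * (1 - c) else 0)) =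
      (if q = m then \<delta> * (1 - c) * (\<Sum>k=1..<m. v k $ j) else 0)"
  proof -
    have "(\<Sum>i\<in>UNIV. v k $ i * (if 1 \<le> k \<and> k < m \<and> q = m \<and> j = i then \<delta> * (1 - c) else 0)) =
        (if k < m \<and> q = m then \<delta> * (1 - c) * v k $ j else 0)" if "k \<in> ?A" for k
      using that by (auto simp: if_distrib[of "(*) _"] cong: if_cong)
    then have "(\<Sum>k\<in>?A. \<Sum>i\<in>UNIV. v k $ i *
          (if 1 \<le> k \<and> k < m \<and> q = m \<and> j = i then \<delta> * (1 - c) else 0)) =
        (\<Sum>k\<in>?A. if k < m \<and> q = m then \<delta> * (1 - c) * v k $ j else 0)"
      by (rule sum.cong[OF refl])
    also have "\<dots> = (if q = m then \<Sum>k=1..<m. \<delta> * (1 - c) * v k $ j else 0)"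
    proof -
      have "(\<Sum>k\<in>?A. if k < m then \<delta> * (1 - c) * v k $ j else 0) = (\<Sum>k=1..<m. \<delta> * (1 - c) * v k $ j)"
        by (rule sum_restrict_level) auto
      then show ?thesis
        by (cases "q = m") (simp_all del: sum.cl_ivl_Suc sum.op_ivl_Suc)
    qed
    finally show ?thesis
      by (simp add: sum_distrib_left)
  qed
  ultimately show ?thesis
    unfolding sum_wf_states wf_rate.simps distrib_left sum.distrib
    by (simp add: v_def)
qed

text \<open>The diagonal entry of \<open>S\<close> occurs in both \<open>rate_out\<close> and
  \<open>rate_in\<close>; it cancels and leaves the full product \<open>v q v* S\<close>.\<close>

lemma phase_balance:
  assumes q: "1 \<le> q" "q \<le> m + 1"
  shows "((if q \<le> m then \<delta> * c else 0) + (if q < m then \<delta> * (1 - c) else 0)) * v q $ j =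
    (v q v* S) $ j + p0 * rate Empty (Busy q j) +
    (if q \<le> m then w (q + 1) * \<alpha> $ j else 0) +
    (if q = m + 1 then \<delta> * c * (\<Sum>k=1..m. v k $ j) else 0) +
    (if q = m then \<delta> * (1 - c) * (\<Sum>k=1..<m. v k $ j) else 0)"
proof -
  have "Busy q j \<in> wf_states m"
    using q by (auto simp: wf_states_def)
  from wf_stationary_balance[OF stationary this] show ?thesis
    unfolding rate_out[OF q] rate_in[OF q] by (simp add: v_def algebra_simps del: wf_rate.simps)
qed

section \<open>Balance equations in vector form\<close>

lemma vector_shifted_mult: "(x v* (mat \<theta> - S)) $ j = \<theta> * x $ j - (x v* S) $ j"
  by (simp add: vector_matrix_mult_def mat_def left_diff_distrib right_diff_distrib sum_subtractf
      if_distrib[of "\<lambda>a. a * _"] if_distrib[of "(*) _"] mult.commute cong: if_cong)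

text \<open>The shift of \<open>S\<close> is the rate at which arrivals leave the level: \<delta>
  below \<open>m\<close>, \<open>\<delta> * c\<close> at level \<open>m\<close> and 0 at the
  top.\<close>

lemma low_level:
  assumes "1 \<le> q" "q < m"
  shows "v q v* (mat \<delta> - S) = w (q + 1) *\<^sub>R \<alpha>"
proof -
  have "(v q v* (mat \<delta> - S)) $ j = w (q + 1) * \<alpha> $ j" for j
    using phase_balance[of q j] assms unfolding vector_shifted_mult by (simp add: algebra_simps)
  then show ?thesis
    by (simp add: vec_eq_iff)
qed

lemma middle_level:
  assumes "1 \<le> m"
  shows "v m v* (mat (\<delta> * c) - S) =
    w (m + 1) *\<^sub>R \<alpha> + (\<delta> * (1 - c)) *\<^sub>R (p0 *\<^sub>R \<alpha> + (\<Sum>k=1..<m. v k))"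
proof -
  have "(v m v* (mat (\<delta> * c) - S)) $ j =
      w (m + 1) * \<alpha> $ j + \<delta> * (1 - c) * (p0 * \<alpha> $ j + (\<Sum>k=1..<m. v k $ j))" for j
    using phase_balance[of m j] assms unfolding vector_shifted_mult by (simp add: algebra_simps)
  then show ?thesis
    by (simp add: vec_eq_iff)
qed

lemma top_level:
  "v (m + 1) v* (mat 0 - S) = (\<delta> * c) *\<^sub>R (p0 *\<^sub>R \<alpha> + (\<Sum>k=1..m. v k))"
proof -
  have "(v (m + 1) v* (mat 0 - S)) $ j = \<delta> * c * (p0 * \<alpha> $ j + (\<Sum>k=1..m. v k $ j))" for j
    using phase_balance[of "m + 1" j] unfolding vector_shifted_mult by (simp add: algebra_simps)
  then show ?thesis
    by (simp add: vec_eq_iff)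
qed

text \<open>\<open>Empty\<close> is left at rate \<delta>, except for \<open>m = 0\<close>, where
  the only jump is to level 1 at rate \<open>\<delta> * c\<close>.\<close>

lemma empty_level: "w 1 = (if m = 0 then \<delta> * c else \<delta>) * p0"
proof -
  let ?A = "{1..m + 1}"
  have "(\<Sum>z\<in>wf_states m. \<pi> z * rate z Empty) = w 1"
  proof -
    have "(\<Sum>k\<in>?A. \<Sum>i\<in>UNIV. v k $ i * (if k = 1 then s $ i else 0)) = w 1"
      by (subst sum_single_level[where a = 1]) (auto simp: w_def inner_vec_def)
    then show ?thesis
      by (simp add: sum_wf_states v_def del: sum.cl_ivl_Suc)
  qed
  moreover have "(\<Sum>z\<in>wf_states m. rate Empty z) = (if m = 0 then \<delta> * c else \<delta>)"
  proof -
    have "(\<Sum>k\<in>?A. \<Sum>i\<in>UNIV. if k = m + 1 then \<delta> * c * \<alpha> $ i else 0) = \<delta> * c"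
      by (subst sum_single_level[where a = "m + 1"]) (auto simp: \<alpha>_sum simp flip: sum_distrib_left)
    moreover have "(\<Sum>k\<in>?A. \<Sum>i\<in>UNIV. if 1 \<le> m \<and> k = m then \<delta> * (1 - c) * \<alpha> $ i else 0) =
        (if m = 0 then 0 else \<delta> * (1 - c))"
      by (subst sum_single_level[where a = m]) (auto simp: \<alpha>_sum simp flip: sum_distrib_left)
    ultimately show ?thesis
      unfolding sum_wf_states wf_rate.simps sum.distrib by (simp add: algebra_simps)
  qed
  moreover have "Empty \<in> wf_states m"
    by (simp add: wf_states_def)
  note wf_stationary_balance[OF stationary this]
  ultimately show ?thesis
    by (subst mult.commute[of _ p0]) simp
qed

section \<open>Scalar identities for the levels\<close>

abbreviation y :: real where "y \<equiv> \<phi> \<delta>"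

abbreviation P :: "nat \<Rightarrow> real" where "P \<equiv> queue_length_prob m \<pi>"

lemma y_pos: "0 < y"
  using \<phi>_pos[of \<delta>] \<delta>_pos by simp

lemma P_0: "P 0 = p0"
proof -
  have "{x. x \<in> wf_states m \<and> queue_length x = 0} = {Empty :: 'a wf_state}"
    by (auto simp: wf_states_def)
  then show ?thesis
    by (simp add: queue_length_prob_def)
qed

lemma P_level:
  assumes "1 \<le> q" "q \<le> m + 1"
  shows "P q = v q \<bullet> 1"
proof -
  have "{x. x \<in> wf_states m \<and> queue_length x = q} = range (Busy q :: 'a \<Rightarrow> _)"
    using assms by (auto simp: wf_states_def)
  then show ?thesis
    by (simp add: queue_length_prob_def sum.reindex inj_def inner_one_eq_sum v_def)
qed

lemma sum_P: "(\<Sum>q<m + 2. P q) = 1"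
proof -
  have "(\<Sum>q<m + 2. P q) = P 0 + (\<Sum>q=1..m + 1. P q)"
    by (simp only: add_2_eq_Suc' sum.lessThan_Suc_shift One_nat_def sum.atLeast1_atMost_eq add_Suc_right add_0_right)
  also have "(\<Sum>q=1..m + 1. P q) = (\<Sum>q=1..m + 1. v q \<bullet> 1)"
    by (intro sum.cong) (auto simp: P_level)
  finally show ?thesis
    using normalization by (simp only: P_0)
qed

text \<open>The vector equation paired with \<open>u \<delta>\<close>, with the all-ones vector and
  with \<open>h\<close>: a geometric recursion, a flow balance and a work balance.\<close>

lemma w_low:
  assumes "1 \<le> q" "q < m"
  shows "w q = y * w (q + 1)" "w q + \<delta> * P q = w (q + 1)" "v q \<bullet> 1 + \<delta> * (v q \<bullet> h) = w (q + 1)"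
proof -
  note low = row_times_matrix_inner[OF low_level[OF assms]]
  show "w q = y * w (q + 1)"
    using low[OF shifted_mult_u] \<delta>_pos by (simp add: w_def \<phi>_eq mult.commute)
  have "(mat \<delta> - S) *v 1 = \<delta> *\<^sub>R 1 + s"
    by (simp add: shifted_mult S_mult_one)
  from low[OF this] show "w q + \<delta> * P q = w (q + 1)"
    using assms by (simp add: w_def P_level inner_add_right \<alpha>_inner_one)
  have "(mat \<delta> - S) *v h = 1 + \<delta> *\<^sub>R h"
    by (simp add: shifted_mult S_mult_h)
  from low[OF this] show "v q \<bullet> 1 + \<delta> * (v q \<bullet> h) = w (q + 1)"
    using assms by (simp add: inner_add_right \<alpha>_inner_h)
qed

lemma w_geometric:
  assumes "1 \<le> q" "q \<le> m"
  shows "w q = \<delta> * p0 / y ^ (q - 1)"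
  using assms
proof (induction q rule: nat_induct_at_least)
  case base
  then show ?case
    using empty_level by simp
next
  case (Suc q)
  then have "y * w (Suc q) = \<delta> * p0 / y ^ (q - 1)"
    using w_low(1)[of q] by simp
  moreover have "y ^ q = y * y ^ (q - 1)"
    using Suc by (cases q) auto
  ultimately show ?case
    using y_pos by (simp add: field_simps)
qed

text \<open>The flow across the cut below level \<open>q\<close>: since \<open>q \<le> m\<close>,
  every arrival from a lower level crosses it.\<close>

lemma level_crossing:
  assumes "1 \<le> q" "q \<le> m"
  shows "w q = \<delta> * (\<Sum>k<q. P k)"
  using assms
proof (induction q rule: nat_induct_at_least)
  case base
  then show ?case
    using empty_level by (simp add: P_0)
next
  case (Suc q)
  then show ?case
    using w_low(2)[of q] by (simp add: distrib_left)
qed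

text \<open>Across the cut below level \<open>m + 1\<close> only the fraction \<open>c\<close> of
  the arrivals moves up.\<close>

lemma level_crossing_top: "w (m + 1) = \<delta> * c * (1 - P (m + 1))"
proof -
  have "(mat 0 - S) *v 1 = s"
    by (simp only: shifted_mult S_mult_one) simp
  from row_times_matrix_inner[OF top_level this]
  have "w (m + 1) = \<delta> * c * (p0 + (\<Sum>k=1..m. v k \<bullet> 1))"
    by (simp add: w_def inner_add_left inner_sum_left \<alpha>_inner_one algebra_simps)
  moreover have "p0 + (\<Sum>k=1..m. v k \<bullet> 1) = 1 - P (m + 1)"
    using normalization by (simp add: P_level)
  ultimately show ?thesis
    by simp
qed

lemma P_low:
  assumes "1 \<le> q" "q < m"
  shows "P q = p0 * (1 / y - 1) / y ^ (q - 1)"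
proof -
  have "y ^ q = y * y ^ (q - 1)"
    using assms by (cases q) auto
  moreover have "\<delta> * P q = \<delta> * p0 / y ^ q - \<delta> * p0 / y ^ (q - 1)"
    using w_low(2)[OF assms] w_geometric[of q] w_geometric[of "q + 1"] assms by simp
  ultimately have "\<delta> * P q = \<delta> * (p0 * (1 / y - 1) / y ^ (q - 1))"
    using y_pos by (simp add: field_simps)
  then show ?thesis
    using \<delta>_pos by (metis mult_left_cancel less_irrefl)
qed

text \<open>The inner products with \<open>h\<close> count the expected remaining work, so this is the balance of work:
  the server is busy for a fraction of time equal to the throughput, as the mean job size is 1.\<close>

lemma work_conservation: "1 - p0 = (\<Sum>q=1..m + 1. w q)"
proof -
  have "(mat 0 - S) *v h = 1"
    by (simp only: shifted_mult S_mult_h) simp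
  from row_times_matrix_inner[OF top_level this]
  have top: "v (m + 1) \<bullet> 1 = \<delta> * c * (p0 + (\<Sum>k=1..m. v k \<bullet> h))"
    by (simp add: inner_add_left inner_sum_left \<alpha>_inner_h algebra_simps)
  have p0: "1 - p0 = (\<Sum>q=1..m. v q \<bullet> 1) + v (m + 1) \<bullet> 1"
    using normalization by simp
  show ?thesis
  proof (cases m)
    case 0
    then show ?thesis
      using p0 top empty_level by simp
  next
    case (Suc n)
    have "(mat (\<delta> * c) - S) *v h = 1 + (\<delta> * c) *\<^sub>R h"
      by (simp add: shifted_mult S_mult_h)
    from row_times_matrix_inner[OF middle_level this]
    have middle: "v m \<bullet> 1 + \<delta> * c * (v m \<bullet> h) =
        w (m + 1) + \<delta> * (1 - c) * (p0 + (\<Sum>k=1..<m. v k \<bullet> h))"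
      using Suc by (simp add: inner_add_left inner_add_right inner_sum_left \<alpha>_inner_h)
    have "(\<Sum>k=1..<m. v k \<bullet> 1) + \<delta> * (\<Sum>k=1..<m. v k \<bullet> h) = (\<Sum>k=1..<m. w (k + 1))"
      using w_low(3) by (simp add: sum_distrib_left flip: sum.distrib)
    moreover have "(\<Sum>k=1..<m. w (k + 1)) + w 1 = (\<Sum>q=1..m. w q)"
      using Suc by (simp add: sum.atLeast_Suc_lessThan sum.shift_bounds_Suc_ivl
          atLeastLessThanSuc_atLeastAtMost[symmetric]
          del: sum.op_ivl_Suc sum.cl_ivl_Suc)
    moreover have "(\<Sum>k=1..m. f k) = (\<Sum>k=1..<m. f k) + f m" for f :: "nat \<Rightarrow> real"
      using Suc by (simp add: atLeastLessThanSuc_atLeastAtMost)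
    \<comment> \<open>On adding up the levels, all inner products with \<open>h\<close> cancel; the
      remaining \<open>\<delta> * p0\<close> is \<open>w 1\<close>.\<close>
    ultimately show ?thesis
      using p0 top middle empty_level Suc by (simp add: algebra_simps)
  qed
qed

text \<open>The completion rate \<open>W\<close> of levels 1 to \<open>m\<close> is computed twice:
  as a geometric series, and by pairing level \<open>m\<close> with
  \<open>u (\<delta> * c)\<close>.\<close>

lemma load_eq: "1 - p0 = \<delta> * p0 * (c + (\<Sum>i<m. (1 / y) ^ i) / \<phi> (\<delta> * c))"
proof -
  define W where "W = (\<Sum>q=1..m. w q)"
  have \<phi>: "0 < \<phi> (\<delta> * c)"
    using \<phi>_pos c \<delta>_pos by simp
  have "W = \<delta> * p0 * (\<Sum>i<m. (1 / y) ^ i)"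
  proof -
    have "W = (\<Sum>q=1..m. \<delta> * p0 / y ^ (q - 1))"
      using w_geometric by (simp add: W_def)
    also have "\<dots> = \<delta> * p0 * (\<Sum>i<m. (1 / y) ^ i)"
      by (simp add: sum.atLeast1_atMost_eq sum_distrib_left power_one_over)
    finally show ?thesis .
  qed
  moreover have "W = \<phi> (\<delta> * c) * (1 - p0 - \<delta> * c * p0)"
  proof (cases m)
    case 0
    then show ?thesis
      using work_conservation empty_level by (simp add: W_def)
  next
    case (Suc n)
    have 0: "0 \<le> \<delta> * c" "0 \<le> \<delta>"
      using c \<delta>_pos by auto
    define R where "R = (\<Sum>k=1..<m. w (k + 1))"
    have "w m = w (m + 1) * \<phi> (\<delta> * c) + \<delta> * (1 - c) * (p0 * \<phi> (\<delta> * c) + (\<Sum>k=1..<m. v k \<bullet> u (\<delta> * c)))"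
      using row_times_matrix_inner[OF middle_level shifted_mult_u[OF 0(1)]] Suc
      by (simp add: w_def inner_add_left inner_sum_left \<phi>_eq)
    \<comment> \<open>The resolvent identity turns the unknown inner products at lower levels into
      completion rates.\<close>
    moreover have "\<delta> * (1 - c) * (v k \<bullet> u (\<delta> * c)) = w (k + 1) * (\<phi> (\<delta> * c) - y)" if "k \<in> {1..<m}" for k
      using row_times_matrix_inner[OF low_level shifted_mult_u_diff[OF 0], of k] that
      by (simp add: \<phi>_eq inner_diff_right algebra_simps)
    then have "\<delta> * (1 - c) * (\<Sum>k=1..<m. v k \<bullet> u (\<delta> * c)) = R * (\<phi> (\<delta> * c) - y)"
      by (simp add: R_def sum_distrib_left sum_distrib_right del: sum.op_ivl_Suc)
    moreover have "W = R + w 1"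
      using Suc by (simp add: W_def R_def sum.atLeast_Suc_lessThan sum.shift_bounds_Suc_ivl
          atLeastLessThanSuc_atLeastAtMost[symmetric]
          del: sum.op_ivl_Suc sum.cl_ivl_Suc)
    moreover have "W = (\<Sum>k=1..<m. w k) + w m"
      using Suc by (simp add: W_def atLeastLessThanSuc_atLeastAtMost)
    moreover have "(\<Sum>k=1..<m. w k) = y * R"
      using w_low(1) by (simp add: R_def sum_distrib_left)
    moreover have "1 - p0 = W + w (m + 1)"
      using work_conservation by (simp add: W_def)
    moreover have "w 1 = \<delta> * p0"
      using empty_level Suc by simp
    ultimately show ?thesis
      by algebra
  qed
  ultimately show ?thesis
    using \<phi> by (simp add: field_simps)
qed

text \<open>The throughput \<open>1 - p0\<close> is rewritten by level crossings and solved for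
  \<open>P (m + 1)\<close>, which enters only through the top cut.\<close>

lemma P_top:
  assumes "c \<noteq> 0"
  shows "P (m + 1) = 1 - 1 / c * ((1 - p0) / \<delta> - (\<Sum>q<m. (real m - real q) * P q))"
proof -
  \<comment> \<open>Each \<open>P k\<close> is counted once for every \<open>q\<close> with
    \<open>k < q \<le> n\<close>.\<close>
  have "(\<Sum>q=1..n. \<Sum>k<q. P k) = (\<Sum>q<n. (real n - real q) * P q)" for n
  proof (induction n)
    case (Suc n)
    have "(\<Sum>q<n. (real (Suc n) - real q) * P q) = (\<Sum>q<n. (real n - real q) * P q) + (\<Sum>q<n. P q)"
      by (simp add: algebra_simps flip: sum.distrib)
    then show ?case
      using Suc by simp
  qed simp
  moreover have "(\<Sum>q=1..m. w q) = (\<Sum>q=1..m. \<delta> * (\<Sum>k<q. P k))"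
    using level_crossing by (intro sum.cong) auto
  ultimately have "1 - p0 = \<delta> * (\<Sum>q<m. (real m - real q) * P q) + \<delta> * c * (1 - P (m + 1))"
    using work_conservation level_crossing_top by (simp flip: sum_distrib_left)
  then show ?thesis
    using assms \<delta>_pos by (simp add: field_simps)
qed

text \<open>For \<open>c = 0\<close>, where \<open>P_top\<close> would divide by 0, level
  \<open>m + 1\<close> is never entered, and its work balance reads 0.\<close>

lemma P_top_zero:
  assumes "c = 0"
  shows "P (m + 1) = 0"
proof -
  have "(mat 0 - S) *v h = 1"
    by (simp only: shifted_mult S_mult_h) simp
  from row_times_matrix_inner[OF top_level this] show ?thesis
    using assms by (simp add: P_level)
qed

text \<open>The cut below level \<open>m\<close> gives the mass of all lower levels; normalization
  does the rest.\<close>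

lemma P_middle:
  assumes "1 \<le> m"
  shows "P m = 1 - p0 * y powi (1 - int m) - P (m + 1)"
proof -
  have "y powi (1 - int m) = 1 / y ^ (m - 1)"
    using assms y_pos by (simp add: power_int_def nat_diff_distrib' field_simps)
  moreover have "\<delta> * (\<Sum>k<m. P k) = \<delta> * (p0 / y ^ (m - 1))"
    using level_crossing[of m] w_geometric[of m] assms by simp
  then have "(\<Sum>k<m. P k) = p0 / y ^ (m - 1)"
    using \<delta>_pos by (metis mult_left_cancel less_irrefl)
  ultimately show ?thesis
    using sum_P by simp
qed

end

section \<open>The parameters of the queue at the cavity\<close>

lemma sum_UNIV_plus:
  "(\<Sum>a\<in>(UNIV :: ('a::finite + 'b::finite) set). f a) =
    (\<Sum>i\<in>UNIV. f (Inl i)) + (\<Sum>j\<in>UNIV. f (Inr j))"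
  by (simp add: sum.Plus flip: UNIV_Plus_UNIV)

context phase_type_job
begin

text \<open>\<open>K_matrix\<close> generates a chain killed by a completion in its first block, and
  \<open>g\<close> is its mean lifetime: the residual service \<open>h\<close>, plus a further
  \<open>1 / f\<close> if the service ends in the second block. From the first block this happens
  with probability \<open>1 - u (\<delta> * c) $ j\<close>.\<close>

lemma K_inverse:
  assumes \<delta>: "0 < \<delta>" and c: "0 \<le> c"
  defines "f \<equiv> \<phi> (\<delta> * c)"
  defines "g \<equiv> (\<chi> a. case a of
      Inl j \<Rightarrow> h $ j + (1 - u (\<delta> * c) $ j) / f
    | Inr j \<Rightarrow> h $ j + 1 / f) :: real^('n + 'n)"
  shows "matrix_inv (- K_matrix \<alpha> S \<delta> c) *v 1 = g"
proof -
  have dc: "0 \<le> \<delta> * c" using \<delta> c by simp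
  have f: "0 < f" using \<phi>_pos[OF dc] by (simp add: f_def)
  define g1 where "g1 = h + (1 / f) *\<^sub>R (1 - u (\<delta> * c))"
  define g2 :: "real^'n" where "g2 = h + (1 / f) *\<^sub>R 1"
  have g: "g $ Inl j = g1 $ j" "g $ Inr j = g2 $ j" for j
    by (simp_all add: g_def g1_def g2_def)
  have "(mat (\<delta> * c) - S) *v g1 = 1 + (\<delta> * c) *\<^sub>R g2"
  proof -
    have "(mat (\<delta> * c) - S) *v g1 =
        (mat (\<delta> * c) - S) *v h + (1 / f) *\<^sub>R ((mat (\<delta> * c) - S) *v 1 - s)"
      by (simp only: g1_def matrix_vector_right_distrib matrix_vector_mult_scaleR
          matrix_vector_mult_diff_distrib shifted_mult_u[OF dc])
    then show ?thesis
      by (simp add: g2_def shifted_mult S_mult_one S_mult_h scaleR_add_right)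
  qed
  moreover have "(mat (\<delta> * c) *v g2) $ i = \<delta> * c * g2 $ i" for i
    by (simp add: mat_mult_vec)
  moreover have "(- K_matrix \<alpha> S \<delta> c *v g) $ Inl i = ((mat (\<delta> * c) - S) *v g1) $ i - (mat (\<delta> * c) *v g2) $ i" for i
    by (simp add: matrix_vector_mult_def sum_UNIV_plus g K_matrix_def left_diff_distrib sum_subtractf sum_negf)
  ultimately have inl: "(- K_matrix \<alpha> S \<delta> c *v g) $ Inl i = 1" for i
    by simp
  have "\<alpha> \<bullet> g1 = 1 / f"
    using f by (simp add: g1_def inner_add_right inner_diff_right \<alpha>_inner_h \<alpha>_inner_one f_def \<phi>_eq field_simps)
  moreover have "S *v g2 = - 1 - (1 / f) *\<^sub>R s"
    by (simp add: g2_def matrix_vector_right_distrib matrix_vector_mult_scaleR S_mult_one S_mult_h)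
  moreover have "(- K_matrix \<alpha> S \<delta> c *v g) $ Inr i = - (s $ i * (\<alpha> \<bullet> g1)) - (S *v g2) $ i" for i
    by (simp add: matrix_vector_mult_def sum_UNIV_plus g K_matrix_def sum_negf inner_vec_def sum_distrib_left mult.assoc)
  ultimately have inr: "(- K_matrix \<alpha> S \<delta> c *v g) $ Inr i = 1" for i
    by simp
  have Kg: "- K_matrix \<alpha> S \<delta> c *v g = 1"
    unfolding vec_eq_iff
  proof
    fix a show "(- K_matrix \<alpha> S \<delta> c *v g) $ a = 1 $ a"
      by (cases a) (simp_all add: inl inr)
  qed
  have "invertible (- K_matrix \<alpha> S \<delta> c)"
  \<comment> \<open>\<open>g\<close> is its own comparison vector: it is positive and mapped to the
    all-ones vector.\<close>
  proof (rule Z_matrix_invertible[of _ g])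
    show "(- K_matrix \<alpha> S \<delta> c) $ a $ b \<le> 0" if "a \<noteq> b" for a b
      using that S_offdiag s_nonneg \<alpha>_nonneg dc by (auto simp: K_matrix_def mat_def split: sum.splits)
    show "0 < g $ a" for a
      using f h_pos u_le_one[OF dc]
      by (cases a) (auto simp: g_def intro!: add_pos_nonneg divide_nonneg_pos)
    show "0 < (- K_matrix \<alpha> S \<delta> c *v g) $ a" for a
      by (simp add: Kg)
  qed
  then show ?thesis
    by (simp add: matrix_inv_mult_eq_iff Kg)
qed

text \<open>\<open>alpha'\<close> is the phase at an independent exponential time of rate \<delta>,
  given that service still runs; its normalizing constant is
  \<open>(1 - \<phi> \<delta>) / \<delta>\<close>.\<close>

lemma alpha'_inner:
  assumes \<delta>: "0 < \<delta>" and z: "(mat \<delta> - S) *v z = x"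
  shows "alpha' \<alpha> S \<delta> \<bullet> x = \<delta> * (\<alpha> \<bullet> z) / (1 - \<phi> \<delta>)"
proof -
  have inv: "(\<alpha> v* matrix_inv (mat \<delta> - S)) \<bullet> x = \<alpha> \<bullet> z" if "(mat \<delta> - S) *v z = x" for x z
    using that matrix_inv_mult_eq_iff[OF shifted_invertible, of \<delta> x z] \<delta> by (simp add: dot_lmul_matrix)
  have "(mat \<delta> - S) *v ((1 / \<delta>) *\<^sub>R (1 - u \<delta>)) = (1 / \<delta>) *\<^sub>R ((mat \<delta> - S) *v 1 - s)"
    using \<delta> by (simp only: matrix_vector_mult_scaleR matrix_vector_mult_diff_distrib shifted_mult_u less_imp_le)
  also have "\<dots> = 1"
    using \<delta> by (simp add: shifted_mult S_mult_one)
  finally have "(\<alpha> v* matrix_inv (mat \<delta> - S)) \<bullet> 1 = (1 - \<phi> \<delta>) / \<delta>"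
    by (simp add: inv inner_diff_right \<alpha>_inner_one \<phi>_eq)
  then show ?thesis
    using inv[OF z] by (simp add: alpha'_def)
qed

lemma sum_power_inverse:
  assumes "0 < (y :: real)" "y < 1"
  shows "(\<Sum>i<m. (1 / y) ^ i) * (1 / y - 1) = (1 / y) ^ m - 1"
  using assms geometric_sum[of "1 / y" m] by simp

text \<open>By \<open>K_inverse\<close>, only the inner products of \<open>\<beta>\<close> with the
  all-ones vector, \<open>h\<close> and \<open>u (\<delta> * c)\<close> enter.\<close>

lemma kappa_formula:
  assumes \<delta>: "0 < \<delta>" and c: "0 \<le> c" "c < 1"
  defines "y \<equiv> \<phi> \<delta>"
  shows "1 / \<delta> + kappa \<alpha> S \<delta> m c \<bullet> (matrix_inv (- K_matrix \<alpha> S \<delta> c) *v 1) =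
    y powi (int m - 1) / \<delta> * (1 + \<delta> * (c + (\<Sum>i<m. (1 / y) ^ i) / \<phi> (\<delta> * c)))"
proof -
  have dc: "0 \<le> \<delta> * c" "0 \<le> \<delta>" using \<delta> c by auto
  define f where "f = \<phi> (\<delta> * c)"
  have f: "0 < f" using \<phi>_pos[OF dc(1)] by (simp add: f_def)
  have y: "0 < y" "y < 1"
    using \<phi>_pos[OF dc(2)] \<phi>_less_one[OF \<delta>] by (simp_all add: y_def)
  define A where "A = (\<Sum>i<m. (1 / y) ^ i)"
  define p where "p = y powi (int m - 1)"
  have "p * y * (1 / y) ^ m = 1"
    using y by (simp add: p_def power_int_diff power_one_over)
  moreover have "A * (1 - y) = y * ((1 / y) ^ m - 1)"
    using sum_power_inverse[OF y, of m] y by (simp add: A_def field_simps)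
  \<comment> \<open>This is how the geometric sum enters; note that \<open>p * y\<close> is
    \<open>y ^ m\<close>, also for \<open>m = 0\<close>.\<close>
  ultimately have pA: "p * A * (1 - y) = 1 - p * y"
    by (simp only: mult.assoc[of p A]) (simp add: right_diff_distrib flip: mult.assoc)
  define a where "a = alpha' \<alpha> S \<delta>"
  define \<beta> where "\<beta> = p *\<^sub>R \<alpha> + (1 - p) *\<^sub>R a"
  have a1: "a \<bullet> 1 = 1"
  proof -
    have "(mat \<delta> - S) *v (1 - u \<delta>) = \<delta> *\<^sub>R 1"
      by (simp only: matrix_vector_mult_diff_distrib shifted_mult_u[OF dc(2)]) (simp add: shifted_mult S_mult_one)
    from alpha'_inner[OF \<delta> this] show ?thesis
      using \<delta> y by (simp add: a_def inner_diff_right \<alpha>_inner_one y_def flip: \<phi>_eq)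
  qed
  have ah: "a \<bullet> h = 1 / (1 - y) - 1 / \<delta>"
  proof -
    have "(mat \<delta> - S) *v h = 1 + \<delta> *\<^sub>R h"
      by (simp add: shifted_mult S_mult_h)
    from alpha'_inner[OF \<delta> this] show ?thesis
      using \<delta> y a1 by (simp add: a_def[symmetric] inner_add_right \<alpha>_inner_h y_def[symmetric] field_simps)
  qed
  have au: "(1 - c) * (a \<bullet> u (\<delta> * c)) = (f - y) / (1 - y)"
  proof -
    have "\<delta> * ((1 - c) * (a \<bullet> u (\<delta> * c))) = \<delta> * ((f - y) / (1 - y))"
      using alpha'_inner[OF \<delta> shifted_mult_u_diff[OF dc]]
      by (simp add: a_def inner_diff_right y_def f_def right_diff_distrib left_diff_distrib flip: \<phi>_eq)
    then show ?thesis
      using \<delta> by (metis mult_left_cancel less_irrefl)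
  qed
  have "kappa \<alpha> S \<delta> m c \<bullet> (matrix_inv (- K_matrix \<alpha> S \<delta> c) *v 1) =
      (1 - c) * (\<beta> \<bullet> (h + (1 / f) *\<^sub>R (1 - u (\<delta> * c)))) + c * (\<beta> \<bullet> (h + (1 / f) *\<^sub>R 1))"
    unfolding K_inverse[OF \<delta> c(1)] inner_vec_def[of "kappa _ _ _ _ _"] sum_UNIV_plus
    by (simp add: kappa_def Let_def \<beta>_def p_def y_def a_def f_def inner_vec_def sum_distrib_left mult.assoc)
  also have "\<dots> = \<beta> \<bullet> h + (\<beta> \<bullet> 1 - (1 - c) * (\<beta> \<bullet> u (\<delta> * c))) / f"
    using f by (simp add: inner_add_right inner_diff_right field_simps)
  also have "\<beta> \<bullet> 1 = 1"
    by (simp add: \<beta>_def inner_add_left \<alpha>_inner_one a1)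
  also have "\<beta> \<bullet> h = p + (1 - p) * (1 / (1 - y) - 1 / \<delta>)"
    by (simp add: \<beta>_def inner_add_left \<alpha>_inner_h ah)
  also have "(1 - c) * (\<beta> \<bullet> u (\<delta> * c)) = (1 - c) * p * f + (1 - p) * ((f - y) / (1 - y))"
    by (simp add: \<beta>_def inner_add_left f_def[symmetric] au[symmetric] algebra_simps flip: \<phi>_eq)
  finally have "kappa \<alpha> S \<delta> m c \<bullet> (matrix_inv (- K_matrix \<alpha> S \<delta> c) *v 1) =
      p + (1 - p) * (1 / (1 - y) - 1 / \<delta>) + (1 - ((1 - c) * p * f + (1 - p) * ((f - y) / (1 - y)))) / f" .
  also have "\<dots> = p / \<delta> * (1 + \<delta> * (c + A / f)) - 1 / \<delta>"
  proof -
    have A: "A * p = (1 - p * y) / (1 - y)"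
      using pA y by (simp add: field_simps)
    have "p / \<delta> * (1 + \<delta> * (c + A / f)) = p / \<delta> + p * c + A * p / f"
      using \<delta> f by (simp add: field_simps)
    \<comment> \<open>Reciprocals become variables with polynomial relations, which brings the
      identity within reach of \<open>algebra\<close>.\<close>
    moreover define t q where "t = 1 / f" and "q = 1 / (1 - y)"
    then have "f * t = 1" "q * (1 - y) = 1"
      using f y by simp_all
    then have "p + (1 - p) * (q - 1 / \<delta>) + (1 - ((1 - c) * p * f + (1 - p) * ((f - y) * q))) * t =
        p * (1 / \<delta>) + p * c + (1 - p * y) * q * t - 1 / \<delta>"
      by algebra
    ultimately show ?thesis
      by (simp add: A t_def q_def)
  qed
  finally show ?thesis
    by (simp add: p_def A_def f_def)
qed

text \<open>By \<open>load_eq\<close>, the odds of a busy server are \<open>\<delta> * G \<delta> m c\<close>. Since \<open>G \<delta> m 1 = G \<delta> (m + 1) 0\<close>,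
  \<open>G\<close> increases continuously from 0 to infinity along the pairs \<open>(m, c)\<close> in lexicographic order.\<close>

definition G :: "real \<Rightarrow> nat \<Rightarrow> real \<Rightarrow> real" where
  "G \<delta> m c = c + (\<Sum>i<m. (1 / \<phi> \<delta>) ^ i) / \<phi> (\<delta> * c)"

text \<open>Strictness comes from the summand \<open>c\<close>; the quotient is merely
  nondecreasing, and is 0 for \<open>m = 0\<close>.\<close>

lemma G_strict_mono:
  assumes "0 < \<delta>" "0 \<le> c" "c < c'"
  shows "G \<delta> m c < G \<delta> m c'"
proof -
  have "\<phi> (\<delta> * c') \<le> \<phi> (\<delta> * c)"
    using assms by (intro \<phi>_lipschitz) auto
  then have "(\<Sum>i<m. (1 / \<phi> \<delta>) ^ i) / \<phi> (\<delta> * c) \<le> (\<Sum>i<m. (1 / \<phi> \<delta>) ^ i) / \<phi> (\<delta> * c')"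
    using assms \<phi>_pos[of \<delta>] \<phi>_pos[of "\<delta> * c'"] by (intro divide_left_mono sum_nonneg mult_pos_pos \<phi>_pos) auto
  then show ?thesis
    using assms by (simp add: G_def)
qed

lemma G_nonneg:
  assumes "0 < \<delta>" "0 \<le> c"
  shows "0 \<le> G \<delta> m c"
  using assms \<phi>_pos[of \<delta>] \<phi>_pos[of "\<delta> * c"] by (auto simp: G_def intro!: add_nonneg_nonneg divide_nonneg_pos sum_nonneg)

lemma G_0: "G \<delta> m 0 = (\<Sum>i<m. (1 / \<phi> \<delta>) ^ i)"
  by (simp add: G_def \<phi>_0)

text \<open>Division by \<open>\<phi> \<delta>\<close> shifts the geometric sum by one, and the
  summand 1 supplies its first term. This joins the pieces of consecutive \<open>m\<close>.\<close>

lemma G_1: "G \<delta> m 1 = (\<Sum>i<Suc m. (1 / \<phi> \<delta>) ^ i)"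
  by (simp add: G_def sum.lessThan_Suc_shift sum_divide_distrib del: sum.lessThan_Suc)

lemma G_bounds:
  assumes "0 < \<delta>" "0 \<le> c" "c < 1"
  shows "(\<Sum>i<m. (1 / \<phi> \<delta>) ^ i) \<le> G \<delta> m c" "G \<delta> m c < (\<Sum>i<Suc m. (1 / \<phi> \<delta>) ^ i)"
  using G_strict_mono[OF assms(1), of 0 c m] G_strict_mono[OF assms, of m] assms(2)
  unfolding G_0 G_1 by (cases "c = 0"; simp add: G_0)+

text \<open>The first partial sum above \<open>r\<close> selects \<open>m\<close>, and the
  intermediate value theorem then yields \<open>c\<close>.\<close>

lemma G_surj:
  assumes \<delta>: "0 < \<delta>" and r: "0 \<le> r"
  shows "\<exists>m c. 0 \<le> c \<and> c < 1 \<and> G \<delta> m c = r"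
proof -
  let ?A = "\<lambda>m. \<Sum>i<m. (1 / \<phi> \<delta>) ^ i"
  have y: "1 \<le> 1 / \<phi> \<delta>"
    using \<phi>_pos[of \<delta>] \<phi>_less_one[OF \<delta>] \<delta> by simp
  \<comment> \<open>The partial sums are unbounded, so some sum exceeds \<open>r\<close>.\<close>
  have ge: "real m \<le> ?A m" for m
    using sum_mono[of "{..<m}" "\<lambda>_. 1" "\<lambda>i. (1 / \<phi> \<delta>) ^ i"] y by (simp add: one_le_power)
  obtain n where "r < ?A n"
    using ge reals_Archimedean2[of r] by (meson less_le_trans)
  define k where "k = (LEAST n. r < ?A n)"
  have k: "r < ?A k"
    unfolding k_def using \<open>r < ?A n\<close> by (rule LeastI)
  moreover from this r obtain m where m: "k = Suc m"
    by (cases k) auto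
  moreover have "?A m \<le> r"
    using not_less_Least[of m "\<lambda>n. r < ?A n"] m by (simp add: k_def)
  ultimately have "G \<delta> m 0 \<le> r" "r < G \<delta> m 1"
    unfolding G_0 G_1 by simp_all
  moreover have "continuous_on {0..1} (G \<delta> m)"
  proof -
    have "continuous_on {0..1} (\<lambda>c. \<phi> (\<delta> * c))"
      using \<delta> by (intro continuous_on_compose2[OF \<phi>_continuous] continuous_intros) auto
    moreover have "\<forall>c\<in>{0..1}. \<phi> (\<delta> * c) \<noteq> 0"
      using \<phi>_pos \<delta> by (metis atLeastAtMost_iff less_irrefl less_imp_le mult_nonneg_nonneg)
    ultimately show ?thesis
      unfolding G_def by (intro continuous_intros) auto
  qed
  ultimately obtain c where "0 \<le> c" "c \<le> 1" "G \<delta> m c = r"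
    using IVT'[of "G \<delta> m" 0 r 1] by auto
  moreover have "c \<noteq> 1"
    using \<open>G \<delta> m c = r\<close> \<open>r < G \<delta> m 1\<close> by auto
  ultimately show ?thesis
    by (metis less_le)
qed

text \<open>The half-open intervals of \<open>G_bounds\<close> are disjoint for different
  \<open>m\<close>; strict monotonicity then fixes \<open>c\<close>.\<close>

lemma G_inj:
  assumes "0 < \<delta>" "0 \<le> c" "c < 1" "0 \<le> c'" "c' < 1" "G \<delta> m c = G \<delta> m' c'"
  shows "m = m' \<and> c = c'"
proof -
  have A: "(\<Sum>i<k. (1 / \<phi> \<delta>) ^ i) \<le> (\<Sum>i<l. (1 / \<phi> \<delta>) ^ i)" if "k \<le> l" for k l
    using that \<phi>_pos[of \<delta>] assms(1) by (intro sum_mono2) auto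
  have "m = m'"
  proof (rule ccontr)
    assume "m \<noteq> m'"
    then have "Suc m \<le> m' \<or> Suc m' \<le> m" by auto
    then show False
      using A[of "Suc m" m'] A[of "Suc m'" m] G_bounds[of \<delta> c m] G_bounds[of \<delta> c' m'] assms by linarith
  qed
  then show ?thesis
    using assms G_strict_mono[of \<delta> c c' m] G_strict_mono[of \<delta> c' c m] by (metis less_irrefl linorder_less_linear)
qed

text \<open>\<open>m_tilde\<close> is the logarithm of \<open>X\<close> to base
  \<open>1 / y\<close>. Multiplied by \<open>1 / y - 1\<close>, the bounds on \<open>G\<close>
  become \<open>(1 / y) ^ m \<le> X < (1 / y) ^ Suc m\<close>.\<close>

lemma floor_m_tilde:
  assumes \<delta>: "0 < \<delta>" and c: "0 \<le> c" "c < 1" and G: "G \<delta> m c = lam / (\<delta> * (1 - lam))"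
  shows "\<lfloor>m_tilde lam \<delta> (\<phi> \<delta>)\<rfloor> = int m"
proof -
  define y where "y = \<phi> \<delta>"
  have y: "0 < y" "y < 1"
    using \<phi>_pos[of \<delta>] \<phi>_less_one[OF \<delta>] \<delta> by (simp_all add: y_def)
  then have y': "0 < 1 / y - 1" by simp
  define r where "r = lam / (\<delta> * (1 - lam))"
  define X where "X = 1 / y + (r - 1) * ((1 - y) / y)"
  have X: "X = 1 + r * (1 / y - 1)"
    using y by (simp add: X_def field_simps)
  have "0 \<le> r"
    using G_nonneg[OF \<delta> c(1), of m] G by (simp add: r_def)
  then have X_pos: "0 < X"
    using y' by (simp add: X add_pos_nonneg)
  have "(1 / y) ^ m \<le> X"
    using mult_right_mono[OF G_bounds(1)[OF \<delta> c, of m] less_imp_le[OF y']] sum_power_inverse[OF y, of m]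
    by (simp only: X G r_def y_def[symmetric])
  then have "real m * ln (1 / y) \<le> ln X"
    using y ln_mono[of "(1 / y) ^ m" X] by (simp add: ln_realpow flip: ln_inverse)
  moreover have "X < (1 / y) ^ Suc m"
    using mult_strict_right_mono[OF G_bounds(2)[OF \<delta> c, of m] y'] sum_power_inverse[OF y, of "Suc m"]
    by (simp only: X G r_def y_def[symmetric])
  then have "ln X < ln ((1 / y) ^ Suc m)"
    using X_pos by simp
  then have "ln X < (real m + 1) * ln (1 / y)"
    using y by (subst (asm) ln_realpow) (simp_all add: add.commute)
  moreover have "0 < ln (1 / y)"
    using y by simp
  ultimately show ?thesis
    unfolding floor_eq_iff m_tilde_def y_def[symmetric] r_def[symmetric] X_def[symmetric]
    by (simp add: pos_le_divide_eq pos_divide_less_eq)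
qed

lemma wf_stationary_exists:
  assumes "0 < \<delta>" "0 \<le> c" "c < 1"
  shows "\<exists>\<pi>. wf_stationary \<alpha> S \<delta> m c \<pi>"
  unfolding wf_stationary_def
proof (rule stationary_distribution_exists[OF finite_wf_states])
  show "wf_states m \<noteq> {}"
    by (auto simp: wf_states_def)
  show "0 \<le> wf_rate \<alpha> S \<delta> m c x z" for x z
    using assms \<alpha>_nonneg s_nonneg S_offdiag by (cases x; cases z) (auto intro!: add_nonneg_nonneg mult_nonneg_nonneg)
qed

section \<open>Cavity parameters in terms of \<open>G\<close>\<close>

lemma load_iff:
  fixes lam :: real
  assumes "0 < \<delta>" "lam < 1"
  shows "(1 - lam) * (1 + \<delta> * g) = 1 \<longleftrightarrow> g = lam / (\<delta> * (1 - lam))"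
  using assms by (simp add: eq_divide_eq) (auto simp: algebra_simps)

text \<open>\<open>load_eq\<close> reads \<open>p0 * (1 + \<delta> * G \<delta> m c) = 1\<close> for
  each stationary \<pi>, so all of them share the same \<open>p0\<close>.\<close>

lemma empty_prob_iff:
  assumes \<delta>: "0 < \<delta>" and c: "0 \<le> c" "c < 1" and "lam < 1" and \<pi>: "wf_stationary \<alpha> S \<delta> m c \<pi>"
  shows "queue_length_prob m \<pi> 0 = 1 - lam \<longleftrightarrow> G \<delta> m c = lam / (\<delta> * (1 - lam))"
proof -
  interpret water_filling \<alpha> S \<delta> m c \<pi>
    using assms by unfold_locales
  have "1 - p0 = \<delta> * p0 * G \<delta> m c"
    using load_eq by (simp add: G_def)
  then have "p0 * (1 + \<delta> * G \<delta> m c) = 1"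
    by (simp add: algebra_simps)
  moreover have "0 < 1 + \<delta> * G \<delta> m c"
    using G_nonneg[OF \<delta> c(1)] \<delta> by (simp add: add_pos_nonneg)
  ultimately show ?thesis
    unfolding P_0 load_iff[OF \<delta> \<open>lam < 1\<close>, symmetric] by (metis mult_right_cancel less_irrefl)
qed

text \<open>From right to left, \<open>wf_stationary_exists\<close> supplies the distribution that
  \<open>cavity_parameters\<close> asks for.\<close>

lemma cavity_parameters_iff:
  assumes "0 < \<delta>" "lam < 1"
  shows "cavity_parameters \<alpha> S \<delta> lam m c \<longleftrightarrow> 0 \<le> c \<and> c < 1 \<and> G \<delta> m c = lam / (\<delta> * (1 - lam))"
  using assms empty_prob_iff wf_stationary_exists unfolding cavity_parameters_def by metis

text \<open>In \<open>kappa_formula\<close> the numerator of the fraction reappears as a factor and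
  cancels.\<close>

lemma kappa_equation_iff:
  assumes \<delta>: "0 < \<delta>" and c: "0 \<le> c" "c < 1" and "lam < 1"
  shows "1 - lam = (\<phi> \<delta> powi (int m - 1) / \<delta>) /
      (1 / \<delta> + kappa \<alpha> S \<delta> m c \<bullet> (matrix_inv (- K_matrix \<alpha> S \<delta> c) *v 1)) \<longleftrightarrow>
    G \<delta> m c = lam / (\<delta> * (1 - lam))"
proof -
  have "0 < \<phi> \<delta> powi (int m - 1) / \<delta>"
    using \<phi>_pos[of \<delta>] \<delta> by simp
  moreover have "0 < 1 + \<delta> * G \<delta> m c"
    using G_nonneg[OF \<delta> c(1)] \<delta> by (simp add: add_pos_nonneg)
  moreover have "x = q / (q * z) \<longleftrightarrow> x * z = 1" if "0 < q" "0 < z" for x q z :: real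
    using that by (auto simp: field_simps)
  ultimately show ?thesis
    unfolding kappa_formula[OF \<delta> c] G_def[symmetric] load_iff[OF \<delta> \<open>lam < 1\<close>, symmetric] by blast
qed

end

theorem theorem5p2:
  fixes \<alpha> :: "real^'n" and S :: "real^'n^'n" and lam \<delta> y :: real
  assumes "phase_type \<alpha> S" and "ph_mean \<alpha> S = 1"
    and "0 \<le> lam" and "lam < 1" and "0 < \<delta>"
    and "y = ph_laplace \<alpha> S \<delta>"
  shows "(\<exists>!p. cavity_parameters \<alpha> S \<delta> lam (fst p) (snd p)) \<and>
    (\<forall>m c. cavity_parameters \<alpha> S \<delta> lam m c \<longrightarrow>
      int m = \<lfloor>m_tilde lam \<delta> y\<rfloor> \<and>
      (\<forall>c'. 0 \<le> c' \<and> c' < 1 \<longrightarrow>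
        (1 - lam = (y powi (int m - 1) / \<delta>) /
            (1 / \<delta> + kappa \<alpha> S \<delta> m c' \<bullet> (matrix_inv (- K_matrix \<alpha> S \<delta> c') *v 1))
          \<longleftrightarrow> c' = c)) \<and>
      (\<forall>\<pi>. wf_stationary \<alpha> S \<delta> m c \<pi> \<longrightarrow>
        queue_length_prob m \<pi> 0 = 1 - lam \<and>
        (\<forall>q\<in>{1..<m}. queue_length_prob m \<pi> q = (1 - lam) * (1 / y - 1) / y ^ (q - 1)) \<and>
        (c \<noteq> 0 \<longrightarrow> queue_length_prob m \<pi> (m + 1) =
          1 - 1 / c * (lam / \<delta> - (\<Sum>q<m. (real m - real q) * queue_length_prob m \<pi> q))) \<and>
        (c = 0 \<longrightarrow> queue_length_prob m \<pi> (m + 1) = 0) \<and>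
        (1 \<le> m \<longrightarrow> queue_length_prob m \<pi> m =
          1 - (1 - lam) * y powi (1 - int m) - queue_length_prob m \<pi> (m + 1))))"
proof -
  interpret phase_type_job \<alpha> S
    using assms(1,2) by unfold_locales
  define r where "r = lam / (\<delta> * (1 - lam))"
  have r: "0 \<le> r"
    using assms by (simp add: r_def)
  note cavity = cavity_parameters_iff[OF \<open>0 < \<delta>\<close> \<open>lam < 1\<close>, folded r_def]
  obtain m0 c0 where c0: "0 \<le> c0" "c0 < 1" and G0: "G \<delta> m0 c0 = r"
    using G_surj[OF \<open>0 < \<delta>\<close> r] by auto
  have ex1: "\<exists>!p. cavity_parameters \<alpha> S \<delta> lam (fst p) (snd p)"
  proof (rule ex1I[of _ "(m0, c0)"])
    show "cavity_parameters \<alpha> S \<delta> lam (fst (m0, c0)) (snd (m0, c0))"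
      by (simp add: cavity c0 G0)
    fix p assume "cavity_parameters \<alpha> S \<delta> lam (fst p) (snd p)"
    then show "p = (m0, c0)"
      unfolding cavity using G_inj[OF \<open>0 < \<delta>\<close> _ _ c0, of "snd p" "fst p" m0] G0 by (simp add: prod_eq_iff)
  qed
  show ?thesis
  proof (intro conjI ex1 allI impI)
    fix m c assume "cavity_parameters \<alpha> S \<delta> lam m c"
    then have c: "0 \<le> c" "c < 1" and G: "G \<delta> m c = r"
      by (simp_all add: cavity)
    show "int m = \<lfloor>m_tilde lam \<delta> y\<rfloor>"
      using floor_m_tilde[OF \<open>0 < \<delta>\<close> c] G assms(6) by (simp add: r_def)
    show "1 - lam = (y powi (int m - 1) / \<delta>) /
        (1 / \<delta> + kappa \<alpha> S \<delta> m c' \<bullet> (matrix_inv (- K_matrix \<alpha> S \<delta> c') *v 1)) \<longleftrightarrow> c' = c"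
      if "0 \<le> c' \<and> c' < 1" for c'
    proof -
      \<comment> \<open>With \<open>m\<close> fixed, the \<open>kappa\<close> equation amounts to
        \<open>G \<delta> m c' = r\<close>, so injectivity of \<open>G\<close> identifies its
        solution.\<close>
      have "G \<delta> m c' = r \<longleftrightarrow> c' = c"
        using that G G_inj[OF \<open>0 < \<delta>\<close> _ _ c, of c' m m] by auto
      then show ?thesis
        using kappa_equation_iff[OF \<open>0 < \<delta>\<close> _ _ \<open>lam < 1\<close>, of c' m] that by (simp add: assms(6) r_def)
    qed
    fix \<pi> assume \<pi>: "wf_stationary \<alpha> S \<delta> m c \<pi>"
    interpret water_filling \<alpha> S \<delta> m c \<pi>
      using \<pi> c assms by unfold_locales
    show P0: "queue_length_prob m \<pi> 0 = 1 - lam"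
      using empty_prob_iff[OF \<open>0 < \<delta>\<close> c \<open>lam < 1\<close> \<pi>] G by (simp add: r_def)
    then have p0: "p0 = 1 - lam"
      by (simp add: P_0)
    show "\<forall>q\<in>{1..<m}. queue_length_prob m \<pi> q = (1 - lam) * (1 / y - 1) / y ^ (q - 1)"
      using P_low p0 assms(6) by simp
    show "queue_length_prob m \<pi> (m + 1) =
        1 - 1 / c * (lam / \<delta> - (\<Sum>q<m. (real m - real q) * queue_length_prob m \<pi> q))" if "c \<noteq> 0"
      using P_top[OF that] by (simp add: p0)
    show "queue_length_prob m \<pi> (m + 1) = 0" if "c = 0"
      using that by (rule P_top_zero)
    show "queue_length_prob m \<pi> m =
        1 - (1 - lam) * y powi (1 - int m) - queue_length_prob m \<pi> (m + 1)" if "1 \<le> m"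
      using P_middle[OF that] by (simp only: p0 assms(6))
  qed
qed

end
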